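(* The class of Guitart exact squares is the smallest class $\mathcal Q$ of squares (closed under isomorphism of squares) that is stable under passage to opposite categories, stable under horizontal composition, satisfies the local descent condition, contains all comma squares, and contains all commutative squares of the form $$\begin{array}{ccc} A&\to& e\\ \downarrow&&\downarrow\\ e&\to& e\end{array}$$ where $A$ is a $0$-connected small category. (That is: the class of Guitart exact squares has all these properties, and is contained in every class of squares having all these properties.)
   Context: $e$ is the terminal (one-object, one-arrow) category. A small category is $0$-connected if it is non-empty and connected (exactly one connected component). For a functor $u:A\to B$ and an object $b$ of $B$, $A/b$ is the category of pairs $(a,g:u(a)\to b)$, a morphism $(a_1,g_1)\to(a_2,g_2)$ being an arrow $f:a_1\to a_2$ of $A$ with $g_2u(f)=g_1$. An object $b$ of $B$ is identified with the functor $b:e\to B$. A square $\mathcal D$ consists of small categories $A,B,A',B'$, functors $v:A'\to A$ (top), $w:B'\to B$ (bottom), $u':A'\to B'$ (left), $u:A\to B$ (right), and a natural transformation $\alpha:uv\to wu'$. It is commutative if $\alpha$ is an identity. It is a comma square if the canonical functor $a'\mapsto (v(a'),u'(a'),\alpha_{a'})$ from $A'$ to the comma category $u\downarrow w$ (objects: triples $(a,b',g:u(a)\to w(b'))$; morphisms: pairs $(f,g')$ with $g_2u(f)=w(g')g_1$) is an isomorphism. An isomorphism of squares consists of isomorphisms of the four categories compatible with the four functors and the natural transformation. $\mathcal D$ is Guitart exact if for all objects $a$ of $A$, $b'$ of $B'$ and every arrow $g:u(a)\to w(b')$ of $B$, the following category $A'_{(a,b',g)}$ is $0$-connected: objects are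 triples $(a',f,g')$ with $a'\in\mathrm{Ob}\,A'$, $f:a\to v(a')$ in $A$, $g':u'(a')\to b'$ in $B'$ such that $w(g')\alpha_{a'}u(f)=g$; morphisms $(a'_1,f_1,g'_1)\to(a'_2,f_2,g'_2)$ are arrows $f':a'_1\to a'_2$ of $A'$ with $v(f')f_1=f_2$ and $g'_2u'(f')=g'_1$. Opposite square: the opposite of $\mathcal D$ has top $u'^{op}:A'^{op}\to B'^{op}$, left $v^{op}:A'^{op}\to A^{op}$, bottom $u^{op}:A^{op}\to B^{op}$, right $w^{op}:B'^{op}\to B^{op}$, and 2-cell $\alpha^{op}$. $\mathcal Q$ is stable under passage to opposite categories if the opposite of every square of $\mathcal Q$ is in $\mathcal Q$. Horizontal composition: given $\mathcal D$ and a square $\mathcal D'$ with top $v':A''\to A'$, bottom $w':B''\to B'$, left $u'':A''\to B''$, right $u'$, and 2-cell $\alpha':u'v'\to w'u''$, the composite $\mathcal D\circ_h\mathcal D'$ has top $vv'$, bottom $ww'$, left $u''$, right $u$ and 2-cell $(w\star\alpha')(\alpha\star v')$. Local descent condition for $\mathcal Q$: for every square $\mathcal D$ with top $v:A'\to A$, bottom $w:B'\to B$, left $u':A'\to B'$, right $u:A\to B$ and 2-cell $\alpha:uv\to wu'$, if for every object $b'$ of $B'$ the composite $\mathcal D\circ_h\mathcal D^{g}_{u',b'}$ is in $\mathcal Q$, then $\mathcal D$ is in $\mathcal Q$. Here $\mathcal D^{g}_{u',b'}$ is the comma square with top the forgetful functor $A'/b'\to A'$, left $A'/b'\to e$, bottom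 $b':e\to B'$, right $u'$, and 2-cell with component $g'$ at $(a',g')$. *)

theory Defs
  imports "HOL-Library.Infinite_Typeclass"
begin

section \<open>Categories and functors\<close>

text \<open>
  Only the values of \<^term>\<open>Dom\<close>, \<^term>\<open>Cod\<close>, \<^term>\<open>Ide\<close>, \<^term>\<open>Comp\<close> on the objects, arrows and
  composable pairs of the category are meaningful; \<open>Comp C g f\<close> is \<open>g\<close> after \<open>f\<close>.  Likewise
  for the object and arrow maps of a functor.
\<close>

record ('o, 'm) cat =
  Obj :: "'o set"
  Arr :: "'m set"
  Dom :: "'m \<Rightarrow> 'o"
  Cod :: "'m \<Rightarrow> 'o"
  Ide :: "'o \<Rightarrow> 'm"
  Comp :: "'m \<Rightarrow> 'm \<Rightarrow> 'm"

definition category :: "('o, 'm) cat \<Rightarrow> bool" where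
  "category C \<longleftrightarrow>
     (\<forall>f\<in>Arr C. Dom C f \<in> Obj C \<and> Cod C f \<in> Obj C) \<and>
     (\<forall>x\<in>Obj C. Ide C x \<in> Arr C \<and> Dom C (Ide C x) = x \<and> Cod C (Ide C x) = x) \<and>
     (\<forall>f\<in>Arr C. \<forall>g\<in>Arr C. Cod C f = Dom C g \<longrightarrow>
        Comp C g f \<in> Arr C \<and> Dom C (Comp C g f) = Dom C f \<and> Cod C (Comp C g f) = Cod C g) \<and>
     (\<forall>f\<in>Arr C. Comp C f (Ide C (Dom C f)) = f \<and> Comp C (Ide C (Cod C f)) f = f) \<and>
     (\<forall>f\<in>Arr C. \<forall>g\<in>Arr C. \<forall>h\<in>Arr C. Cod C f = Dom C g \<and> Cod C g = Dom C h \<longrightarrow>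
        Comp C h (Comp C g f) = Comp C (Comp C h g) f)"

definition opp_cat :: "('o, 'm) cat \<Rightarrow> ('o, 'm) cat" where
  "opp_cat C = \<lparr>Obj = Obj C, Arr = Arr C, Dom = Cod C, Cod = Dom C, Ide = Ide C,
                Comp = (\<lambda>g f. Comp C f g)\<rparr>"

definition zigzag :: "('o, 'm) cat \<Rightarrow> ('o \<times> 'o) set" where
  "zigzag C = ({(Dom C f, Cod C f) | f. f \<in> Arr C} \<union> {(Cod C f, Dom C f) | f. f \<in> Arr C})\<^sup>*"

definition zero_connected :: "('o, 'm) cat \<Rightarrow> bool" where
  "zero_connected C \<longleftrightarrow> Obj C \<noteq> {} \<and> (\<forall>x\<in>Obj C. \<forall>y\<in>Obj C. (x, y) \<in> zigzag C)"

record ('o, 'm, 'p, 'n) fctr =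
  ob :: "'o \<Rightarrow> 'p"
  ar :: "'m \<Rightarrow> 'n"

definition is_functor ::
  "('o, 'm) cat \<Rightarrow> ('p, 'n) cat \<Rightarrow> ('o, 'm, 'p, 'n) fctr \<Rightarrow> bool" where
  "is_functor A B F \<longleftrightarrow>
     (\<forall>x\<in>Obj A. ob F x \<in> Obj B) \<and>
     (\<forall>f\<in>Arr A. ar F f \<in> Arr B \<and> Dom B (ar F f) = ob F (Dom A f) \<and> Cod B (ar F f) = ob F (Cod A f)) \<and>
     (\<forall>x\<in>Obj A. ar F (Ide A x) = Ide B (ob F x)) \<and>
     (\<forall>f\<in>Arr A. \<forall>g\<in>Arr A. Cod A f = Dom A g \<longrightarrow> ar F (Comp A g f) = Comp B (ar F g) (ar F f))"

definition id_fctr :: "('o, 'm, 'o, 'm) fctr" where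
  "id_fctr = \<lparr>ob = (\<lambda>x. x), ar = (\<lambda>f. f)\<rparr>"

definition comp_fctr ::
  "('p, 'n, 'q, 'l) fctr \<Rightarrow> ('o, 'm, 'p, 'n) fctr \<Rightarrow> ('o, 'm, 'q, 'l) fctr" where
  "comp_fctr G F = \<lparr>ob = ob G \<circ> ob F, ar = ar G \<circ> ar F\<rparr>"

text \<open>Equality of functors with source \<open>A\<close>.\<close>

definition eq_fctr ::
  "('o, 'm) cat \<Rightarrow> ('o, 'm, 'p, 'n) fctr \<Rightarrow> ('o, 'm, 'p, 'n) fctr \<Rightarrow> bool" where
  "eq_fctr A F G \<longleftrightarrow> (\<forall>x\<in>Obj A. ob F x = ob G x) \<and> (\<forall>f\<in>Arr A. ar F f = ar G f)"

definition is_iso_fctr ::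
  "('o, 'm) cat \<Rightarrow> ('p, 'n) cat \<Rightarrow> ('o, 'm, 'p, 'n) fctr \<Rightarrow> bool" where
  "is_iso_fctr A B F \<longleftrightarrow> is_functor A B F \<and>
     (\<exists>G. is_functor B A G \<and> eq_fctr A (comp_fctr G F) id_fctr \<and> eq_fctr B (comp_fctr F G) id_fctr)"

definition is_nat_trans ::
  "('o, 'm) cat \<Rightarrow> ('p, 'n) cat \<Rightarrow> ('o, 'm, 'p, 'n) fctr \<Rightarrow> ('o, 'm, 'p, 'n) fctr \<Rightarrow> ('o \<Rightarrow> 'n) \<Rightarrow> bool"
where
  "is_nat_trans A B F G \<tau> \<longleftrightarrow>
     (\<forall>x\<in>Obj A. \<tau> x \<in> Arr B \<and> Dom B (\<tau> x) = ob F x \<and> Cod B (\<tau> x) = ob G x) \<and>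
     (\<forall>f\<in>Arr A. Comp B (\<tau> (Cod A f)) (ar F f) = Comp B (ar G f) (\<tau> (Dom A f)))"

text \<open>In the two categories below an arrow is a triple (source, underlying arrow(s), target).\<close>

definition comma_cat ::
  "('o, 'm) cat \<Rightarrow> ('p, 'n) cat \<Rightarrow> ('q, 'l) cat \<Rightarrow> ('o, 'm, 'q, 'l) fctr \<Rightarrow> ('p, 'n, 'q, 'l) fctr \<Rightarrow>
   ('o \<times> 'p \<times> 'l, ('o \<times> 'p \<times> 'l) \<times> ('m \<times> 'n) \<times> ('o \<times> 'p \<times> 'l)) cat" where
  "comma_cat A B' B u w =
    (let obs = {(a, b', g). a \<in> Obj A \<and> b' \<in> Obj B' \<and> g \<in> Arr B \<and>
                            Dom B g = ob u a \<and> Cod B g = ob w b'}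
     in \<lparr>Obj = obs,
         Arr = {((a1, b1, g1), (f, g'), (a2, b2, g2)).
                  (a1, b1, g1) \<in> obs \<and> (a2, b2, g2) \<in> obs \<and>
                  f \<in> Arr A \<and> Dom A f = a1 \<and> Cod A f = a2 \<and>
                  g' \<in> Arr B' \<and> Dom B' g' = b1 \<and> Cod B' g' = b2 \<and>
                  Comp B g2 (ar u f) = Comp B (ar w g') g1},
         Dom = (\<lambda>(x, h, y). x),
         Cod = (\<lambda>(x, h, y). y),
         Ide = (\<lambda>(a, b', g). ((a, b', g), (Ide A a, Ide B' b'), (a, b', g))),
         Comp = (\<lambda>(y, (k, k'), z) (x, (f, f'), y'). (x, (Comp A k f, Comp B' k' f'), z))\<rparr>)"

definition slice_cat ::
  "('o, 'm) cat \<Rightarrow> ('p, 'n) cat \<Rightarrow> ('o, 'm, 'p, 'n) fctr \<Rightarrow> 'p \<Rightarrow>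
   ('o \<times> 'n, ('o \<times> 'n) \<times> 'm \<times> ('o \<times> 'n)) cat" where
  "slice_cat A B u b =
    (let obs = {(a, g). a \<in> Obj A \<and> g \<in> Arr B \<and> Dom B g = ob u a \<and> Cod B g = b}
     in \<lparr>Obj = obs,
         Arr = {((a1, g1), f, (a2, g2)).
                  (a1, g1) \<in> obs \<and> (a2, g2) \<in> obs \<and>
                  f \<in> Arr A \<and> Dom A f = a1 \<and> Cod A f = a2 \<and> Comp B g2 (ar u f) = g1},
         Dom = (\<lambda>(x, f, y). x),
         Cod = (\<lambda>(x, f, y). y),
         Ide = (\<lambda>(a, g). ((a, g), Ide A a, (a, g))),
         Comp = (\<lambda>(y, k, z) (x, f, y'). (x, Comp A k f, z))\<rparr>)"

section \<open>Small categories and encoding of pairs\<close>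

text \<open>
  The objects and the arrows of a small category are taken from one arbitrary infinite type
  \<open>'u\<close>, which plays the role of the universe.  Slices have pairs and triples as objects and arrows;
  these are coded back into \<open>'u\<close>.  The classes of squares below being closed under
  isomorphism, nothing depends on the choice of the coding.
\<close>

type_synonym 'u small_cat = "('u, 'u) cat"
type_synonym 'u small_fctr = "('u, 'u, 'u, 'u) fctr"

definition pair_code :: "'u::infinite \<times> 'u \<Rightarrow> 'u" where
  "pair_code = (SOME c. inj c)"

lemma inj_pair_code: "inj (pair_code :: 'u::infinite \<times> 'u \<Rightarrow> 'u)"
proof -
  have "(card_of (UNIV \<times> UNIV :: ('u \<times> 'u) set), card_of (UNIV :: 'u set)) \<in> ordLeq"
    by (rule ordIso_imp_ordLeq[OF card_of_Times_same_infinite[OF infinite_UNIV]])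
  then have "\<exists>c :: 'u \<times> 'u \<Rightarrow> 'u. inj c"
    unfolding card_of_ordLeq[symmetric] by auto
  then show ?thesis
    unfolding pair_code_def by (rule someI_ex)
qed

definition slice_arr_code :: "('u::infinite \<times> 'u) \<times> 'u \<times> ('u \<times> 'u) \<Rightarrow> 'u" where
  "slice_arr_code = (\<lambda>(x, f, y). pair_code (pair_code x, pair_code (f, pair_code y)))"

text \<open>The isomorphic copy of a category along injections of its objects and arrows.\<close>

definition copy_cat :: "('o \<Rightarrow> 'p) \<Rightarrow> ('m \<Rightarrow> 'n) \<Rightarrow> ('o, 'm) cat \<Rightarrow> ('p, 'n) cat" where
  "copy_cat i j C =
     \<lparr>Obj = i ` Obj C, Arr = j ` Arr C,
      Dom = (\<lambda>k. i (Dom C (inv j k))),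
      Cod = (\<lambda>k. i (Cod C (inv j k))),
      Ide = (\<lambda>x. j (Ide C (inv i x))),
      Comp = (\<lambda>k l. j (Comp C (inv j k) (inv j l)))\<rparr>"

definition terminal_cat :: "'u small_cat" where
  "terminal_cat = \<lparr>Obj = {undefined}, Arr = {undefined}, Dom = (\<lambda>_. undefined),
                   Cod = (\<lambda>_. undefined), Ide = (\<lambda>_. undefined), Comp = (\<lambda>_ _. undefined)\<rparr>"

definition const_fctr :: "('p, 'n) cat \<Rightarrow> 'p \<Rightarrow> ('o, 'm, 'p, 'n) fctr" where
  "const_fctr B b = \<lparr>ob = (\<lambda>_. b), ar = (\<lambda>_. Ide B b)\<rparr>"

section \<open>Squares\<close>

text \<open>
  The four corners are \<open>TL = A'\<close>, \<open>TR = A\<close>, \<open>BL = B'\<close>, \<open>BR = B\<close>, and the sides are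
  \<open>top = v\<close>, \<open>bottom = w\<close>, \<open>left = u'\<close>, \<open>right = u\<close>.
\<close>

record 'u square =
  TL :: "'u small_cat"
  TR :: "'u small_cat"
  BL :: "'u small_cat"
  BR :: "'u small_cat"
  top_fctr :: "'u small_fctr"
  bottom_fctr :: "'u small_fctr"
  left_fctr :: "'u small_fctr"
  right_fctr :: "'u small_fctr"
  two_cell :: "'u \<Rightarrow> 'u"

definition is_square :: "'u square \<Rightarrow> bool" where
  "is_square D \<longleftrightarrow>
     category (TL D) \<and> category (TR D) \<and> category (BL D) \<and> category (BR D) \<and>
     is_functor (TL D) (TR D) (top_fctr D) \<and> is_functor (BL D) (BR D) (bottom_fctr D) \<and>
     is_functor (TL D) (BL D) (left_fctr D) \<and> is_functor (TR D) (BR D) (right_fctr D) \<and>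
     is_nat_trans (TL D) (BR D) (comp_fctr (right_fctr D) (top_fctr D))
       (comp_fctr (bottom_fctr D) (left_fctr D)) (two_cell D)"

definition commutative_square :: "'u square \<Rightarrow> bool" where
  "commutative_square D \<longleftrightarrow> is_square D \<and>
     eq_fctr (TL D) (comp_fctr (right_fctr D) (top_fctr D)) (comp_fctr (bottom_fctr D) (left_fctr D)) \<and>
     (\<forall>x\<in>Obj (TL D). two_cell D x = Ide (BR D) (ob (right_fctr D) (ob (top_fctr D) x)))"

definition comma_comparison ::
  "'u square \<Rightarrow> ('u, 'u, 'u \<times> 'u \<times> 'u, ('u \<times> 'u \<times> 'u) \<times> ('u \<times> 'u) \<times> ('u \<times> 'u \<times> 'u)) fctr" where
  "comma_comparison D =
    (let k = (\<lambda>x. (ob (top_fctr D) x, ob (left_fctr D) x, two_cell D x))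
     in \<lparr>ob = k,
         ar = (\<lambda>f. (k (Dom (TL D) f), (ar (top_fctr D) f, ar (left_fctr D) f), k (Cod (TL D) f)))\<rparr>)"

definition comma_square :: "'u square \<Rightarrow> bool" where
  "comma_square D \<longleftrightarrow> is_square D \<and>
     is_iso_fctr (TL D) (comma_cat (TR D) (BL D) (BR D) (right_fctr D) (bottom_fctr D))
       (comma_comparison D)"

definition iso_square :: "'u square \<Rightarrow> 'u square \<Rightarrow> bool" where
  "iso_square D E \<longleftrightarrow> is_square D \<and> is_square E \<and>
     (\<exists>TLi TRi BLi BRi.
        is_iso_fctr (TL D) (TL E) TLi \<and> is_iso_fctr (TR D) (TR E) TRi \<and>
        is_iso_fctr (BL D) (BL E) BLi \<and> is_iso_fctr (BR D) (BR E) BRi \<and>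
        eq_fctr (TL D) (comp_fctr (top_fctr E) TLi) (comp_fctr TRi (top_fctr D)) \<and>
        eq_fctr (BL D) (comp_fctr (bottom_fctr E) BLi) (comp_fctr BRi (bottom_fctr D)) \<and>
        eq_fctr (TL D) (comp_fctr (left_fctr E) TLi) (comp_fctr BLi (left_fctr D)) \<and>
        eq_fctr (TR D) (comp_fctr (right_fctr E) TRi) (comp_fctr BRi (right_fctr D)) \<and>
        (\<forall>x\<in>Obj (TL D). two_cell E (ob TLi x) = ar BRi (two_cell D x)))"

definition opp_square :: "'u square \<Rightarrow> 'u square" where
  "opp_square D =
     \<lparr>TL = opp_cat (TL D), TR = opp_cat (BL D), BL = opp_cat (TR D), BR = opp_cat (BR D),
      top_fctr = left_fctr D, bottom_fctr = right_fctr D,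
      left_fctr = top_fctr D, right_fctr = bottom_fctr D, two_cell = two_cell D\<rparr>"

text \<open>
  Requiring literal equality of the common side, values outside the carriers included, is
  harmless for classes closed under isomorphism.
\<close>

definition h_composable :: "'u square \<Rightarrow> 'u square \<Rightarrow> bool" where
  "h_composable D D' \<longleftrightarrow> TL D = TR D' \<and> BL D = BR D' \<and> left_fctr D = right_fctr D'"

definition h_comp :: "'u square \<Rightarrow> 'u square \<Rightarrow> 'u square" where
  "h_comp D D' =
     \<lparr>TL = TL D', TR = TR D, BL = BL D', BR = BR D,
      top_fctr = comp_fctr (top_fctr D) (top_fctr D'),
      bottom_fctr = comp_fctr (bottom_fctr D) (bottom_fctr D'),
      left_fctr = left_fctr D', right_fctr = right_fctr D,
      two_cell = (\<lambda>x. Comp (BR D) (ar (bottom_fctr D) (two_cell D' x))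
                                   (two_cell D (ob (top_fctr D') x)))\<rparr>"

definition slice_square ::
  "('u::infinite) small_cat \<Rightarrow> 'u small_cat \<Rightarrow> 'u small_fctr \<Rightarrow> 'u \<Rightarrow> 'u square" where
  "slice_square A B u b =
     \<lparr>TL = copy_cat pair_code slice_arr_code (slice_cat A B u b),
      TR = A, BL = terminal_cat, BR = B,
      top_fctr = \<lparr>ob = (\<lambda>p. fst (inv pair_code p)),
                  ar = (\<lambda>k. fst (snd (inv slice_arr_code k)))\<rparr>,
      bottom_fctr = const_fctr B b,
      left_fctr = const_fctr terminal_cat undefined,
      right_fctr = u,
      two_cell = (\<lambda>p. snd (inv pair_code p))\<rparr>"

section \<open>Guitart exact squares\<close>

text \<open>The category \<open>A'\<^bsub>(a,b',g)\<^esub>\<close>; arrows are again triples (source, underlying arrow, target).\<close>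

definition guitart_cat ::
  "'u square \<Rightarrow> 'u \<Rightarrow> 'u \<Rightarrow> 'u \<Rightarrow> ('u \<times> 'u \<times> 'u, ('u \<times> 'u \<times> 'u) \<times> 'u \<times> ('u \<times> 'u \<times> 'u)) cat" where
  "guitart_cat D a b' g =
    (let A' = TL D; A = TR D; B' = BL D; B = BR D;
         v = top_fctr D; w = bottom_fctr D; u' = left_fctr D; u = right_fctr D; \<alpha> = two_cell D;
         obs = {(a', f, g'). a' \<in> Obj A' \<and>
                  f \<in> Arr A \<and> Dom A f = a \<and> Cod A f = ob v a' \<and>
                  g' \<in> Arr B' \<and> Dom B' g' = ob u' a' \<and> Cod B' g' = b' \<and>
                  Comp B (ar w g') (Comp B (\<alpha> a') (ar u f)) = g}
     in \<lparr>Obj = obs,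
         Arr = {((a1, f1, g1), f', (a2, f2, g2)).
                  (a1, f1, g1) \<in> obs \<and> (a2, f2, g2) \<in> obs \<and>
                  f' \<in> Arr A' \<and> Dom A' f' = a1 \<and> Cod A' f' = a2 \<and>
                  Comp A (ar v f') f1 = f2 \<and> Comp B' g2 (ar u' f') = g1},
         Dom = (\<lambda>(x, f', y). x),
         Cod = (\<lambda>(x, f', y). y),
         Ide = (\<lambda>(a', f, g'). ((a', f, g'), Ide A' a', (a', f, g'))),
         Comp = (\<lambda>(y, k, z) (x, f', y'). (x, Comp A' k f', z))\<rparr>)"

definition guitart_exact :: "'u square \<Rightarrow> bool" where
  "guitart_exact D \<longleftrightarrow> is_square D \<and>
     (\<forall>a\<in>Obj (TR D). \<forall>b'\<in>Obj (BL D). \<forall>g\<in>Arr (BR D).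
        Dom (BR D) g = ob (right_fctr D) a \<and> Cod (BR D) g = ob (bottom_fctr D) b' \<longrightarrow>
        zero_connected (guitart_cat D a b' g))"

section \<open>Properties of classes of squares\<close>

definition iso_closed :: "'u square set \<Rightarrow> bool" where
  "iso_closed Q \<longleftrightarrow> (\<forall>D E. D \<in> Q \<and> iso_square D E \<longrightarrow> E \<in> Q)"

definition opp_stable :: "'u square set \<Rightarrow> bool" where
  "opp_stable Q \<longleftrightarrow> (\<forall>D\<in>Q. opp_square D \<in> Q)"

definition h_comp_stable :: "'u square set \<Rightarrow> bool" where
  "h_comp_stable Q \<longleftrightarrow> (\<forall>D\<in>Q. \<forall>D'\<in>Q. h_composable D D' \<longrightarrow> h_comp D D' \<in> Q)"

definition local_descent :: "('u::infinite) square set \<Rightarrow> bool" where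
  "local_descent Q \<longleftrightarrow>
     (\<forall>D. is_square D \<and>
          (\<forall>b'\<in>Obj (BL D). h_comp D (slice_square (TL D) (BL D) (left_fctr D) b') \<in> Q)
        \<longrightarrow> D \<in> Q)"

definition contains_comma_squares :: "'u square set \<Rightarrow> bool" where
  "contains_comma_squares Q \<longleftrightarrow> (\<forall>D. comma_square D \<longrightarrow> D \<in> Q)"

definition contains_connected_squares :: "'u square set \<Rightarrow> bool" where
  "contains_connected_squares Q \<longleftrightarrow>
     (\<forall>D. commutative_square D \<and> zero_connected (TL D) \<and>
          TR D = terminal_cat \<and> BL D = terminal_cat \<and> BR D = terminal_cat \<longrightarrow> D \<in> Q)"

definition guitart_class :: "('u::infinite) square set \<Rightarrow> bool" where
  "guitart_class Q \<longleftrightarrow> Q \<subseteq> {D. is_square D} \<and> iso_closed Q \<and> opp_stable Q \<and> h_comp_stable Q \<and>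
     local_descent Q \<and> contains_comma_squares Q \<and> contains_connected_squares Q"

end

(* Minimality.  Descent along the slices A'/b' reduces an exact square to one with B' = e; passing
   to the opposite square and descending again, it is enough to treat A = B' = e.  Such a square is
   a map from A' to the set Hom(x, y) in B, exactness saying that its fibres are 0-connected.  It is
   the horizontal composite of the comma square on Hom(x, y) with a square over e -> e, and one more
   descent for the opposite of the latter leaves the fibres themselves, over three copies of e. *)
theory Submission
  imports Defs
begin

section \<open>Categories, functors and zigzags\<close>

text \<open>Descent changes only \<open>TL\<close> and \<open>BL\<close>: it puts e in place of
  \<open>BL\<close> and a slice in place of \<open>TL\<close>. Passing to opposites exchanges
  \<open>TR\<close> and \<open>BL\<close>. Neither can alter \<open>BR\<close>, except to its
  opposite, whereas the generating squares other than comma squares lie over e. The obstacle is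
  therefore to get rid of B, and only horizontal composition can do it, with a comma square as the
  factor that carries B. This becomes possible once A = B' = e: naturality then makes the 2-cell
  constant along the arrows of A', so that it is a functor to the discrete category on Hom(x, y),
  which is the comma category of x and y. Exactness survives the reduction because slice squares are
  exact and exact squares compose, so these facts serve both halves of the theorem. Composition
  rests on a principle about 0-connectedness, \<open>zero_connected_cover\<close>: connected pieces,
  indexed by a connected base and linked along its arrows, make up a connected whole.\<close>

lemma cat_Dom: "category C \<Longrightarrow> f \<in> Arr C \<Longrightarrow> Dom C f \<in> Obj C"
  and cat_Cod: "category C \<Longrightarrow> f \<in> Arr C \<Longrightarrow> Cod C f \<in> Obj C"
  and cat_Ide: "category C \<Longrightarrow> x \<in> Obj C \<Longrightarrow> Ide C x \<in> Arr C"
  and cat_Dom_Ide: "category C \<Longrightarrow> x \<in> Obj C \<Longrightarrow> Dom C (Ide C x) = x"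
  and cat_Cod_Ide: "category C \<Longrightarrow> x \<in> Obj C \<Longrightarrow> Cod C (Ide C x) = x"
  and cat_Comp: "category C \<Longrightarrow> f \<in> Arr C \<Longrightarrow> g \<in> Arr C \<Longrightarrow> Cod C f = Dom C g \<Longrightarrow> Comp C g f \<in> Arr C"
  and cat_Dom_Comp:
    "category C \<Longrightarrow> f \<in> Arr C \<Longrightarrow> g \<in> Arr C \<Longrightarrow> Cod C f = Dom C g \<Longrightarrow> Dom C (Comp C g f) = Dom C f"
  and cat_Cod_Comp:
    "category C \<Longrightarrow> f \<in> Arr C \<Longrightarrow> g \<in> Arr C \<Longrightarrow> Cod C f = Dom C g \<Longrightarrow> Cod C (Comp C g f) = Cod C g"
  and cat_Comp_Ide: "category C \<Longrightarrow> f \<in> Arr C \<Longrightarrow> Dom C f = x \<Longrightarrow> Comp C f (Ide C x) = f"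
  and cat_Ide_Comp: "category C \<Longrightarrow> f \<in> Arr C \<Longrightarrow> Cod C f = x \<Longrightarrow> Comp C (Ide C x) f = f"
  and cat_assoc:
    "category C \<Longrightarrow> f \<in> Arr C \<Longrightarrow> g \<in> Arr C \<Longrightarrow> h \<in> Arr C \<Longrightarrow> Cod C f = Dom C g \<Longrightarrow> Cod C g = Dom C h \<Longrightarrow>
      Comp C (Comp C h g) f = Comp C h (Comp C g f)"
  by (auto simp: category_def)

lemmas cat_simps = cat_Dom cat_Cod cat_Ide cat_Dom_Ide cat_Cod_Ide cat_Comp cat_Dom_Comp cat_Cod_Comp
  cat_Comp_Ide cat_Ide_Comp

lemma fctr_ob: "is_functor A B F \<Longrightarrow> x \<in> Obj A \<Longrightarrow> ob F x \<in> Obj B"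
  and fctr_ar: "is_functor A B F \<Longrightarrow> f \<in> Arr A \<Longrightarrow> ar F f \<in> Arr B"
  and fctr_Dom: "is_functor A B F \<Longrightarrow> f \<in> Arr A \<Longrightarrow> Dom B (ar F f) = ob F (Dom A f)"
  and fctr_Cod: "is_functor A B F \<Longrightarrow> f \<in> Arr A \<Longrightarrow> Cod B (ar F f) = ob F (Cod A f)"
  and fctr_Ide: "is_functor A B F \<Longrightarrow> x \<in> Obj A \<Longrightarrow> ar F (Ide A x) = Ide B (ob F x)"
  and fctr_Comp: "is_functor A B F \<Longrightarrow> f \<in> Arr A \<Longrightarrow> g \<in> Arr A \<Longrightarrow> Cod A f = Dom A g \<Longrightarrow>
      ar F (Comp A g f) = Comp B (ar F g) (ar F f)"
  by (auto simp: is_functor_def)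

lemmas fctr_simps = fctr_ob fctr_ar fctr_Dom fctr_Cod fctr_Ide fctr_Comp

lemma comp_fctr_simps [simp]:
  "ob (comp_fctr G F) x = ob G (ob F x)" "ar (comp_fctr G F) f = ar G (ar F f)"
  by (simp_all add: comp_fctr_def)

lemma id_fctr_simps [simp]: "ob id_fctr x = x" "ar id_fctr f = f"
  by (simp_all add: id_fctr_def)

lemma is_functor_comp:
  "is_functor A B F \<Longrightarrow> is_functor B C G \<Longrightarrow> is_functor A C (comp_fctr G F)"
  by (auto simp: is_functor_def)

lemma is_iso_fctr_id: "is_iso_fctr C C id_fctr"
  unfolding is_iso_fctr_def
  by (intro conjI exI[of _ id_fctr]) (auto simp: is_functor_def eq_fctr_def)

lemma iso_fctr:
  assumes F: "is_iso_fctr A B F"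
  shows iso_fctr_functor: "is_functor A B F"
    and iso_fctr_ob_surj: "y \<in> Obj B \<Longrightarrow> \<exists>x\<in>Obj A. y = ob F x"
    and iso_fctr_ar_surj: "g \<in> Arr B \<Longrightarrow> \<exists>f\<in>Arr A. g = ar F f"
    and iso_fctr_ob_inj: "x \<in> Obj A \<Longrightarrow> x' \<in> Obj A \<Longrightarrow> ob F x = ob F x' \<longleftrightarrow> x = x'"
    and iso_fctr_ar_inj: "f \<in> Arr A \<Longrightarrow> f' \<in> Arr A \<Longrightarrow> ar F f = ar F f' \<longleftrightarrow> f = f'"
proof -
  obtain G where G: "is_functor B A G" "\<And>x. x \<in> Obj A \<Longrightarrow> ob G (ob F x) = x"
    "\<And>f. f \<in> Arr A \<Longrightarrow> ar G (ar F f) = f" "\<And>y. y \<in> Obj B \<Longrightarrow> ob F (ob G y) = y"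
    "\<And>g. g \<in> Arr B \<Longrightarrow> ar F (ar G g) = g"
    using F by (auto simp: is_iso_fctr_def eq_fctr_def)
  show "is_functor A B F" using F by (simp add: is_iso_fctr_def)
  show "\<exists>x\<in>Obj A. y = ob F x" if "y \<in> Obj B"
    using that G(4) fctr_ob[OF G(1)] by (intro bexI[of _ "ob G y"]) auto
  show "\<exists>f\<in>Arr A. g = ar F f" if "g \<in> Arr B"
    using that G(5) fctr_ar[OF G(1)] by (intro bexI[of _ "ar G g"]) auto
  show "ob F x = ob F x' \<longleftrightarrow> x = x'" if "x \<in> Obj A" "x' \<in> Obj A"
    using that G(2) by metis
  show "ar F f = ar F f' \<longleftrightarrow> f = f'" if "f \<in> Arr A" "f' \<in> Arr A"
    using that G(3) by metis
qed

section \<open>Opposite, terminal and copied categories\<close>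

lemma category_opp: "category C \<Longrightarrow> category (opp_cat C)"
  by (auto simp: category_def opp_cat_def)

lemma opp_cat_opp [simp]: "opp_cat (opp_cat C) = C"
  by (simp add: opp_cat_def)

lemma is_functor_opp: "is_functor A B F \<Longrightarrow> is_functor (opp_cat A) (opp_cat B) F"
  by (auto simp: is_functor_def opp_cat_def)

lemma category_terminal: "category terminal_cat"
  by (simp add: category_def terminal_cat_def)

lemma opp_terminal [simp]: "opp_cat terminal_cat = terminal_cat"
  by (simp add: terminal_cat_def opp_cat_def)

lemma terminal_simps [simp]:
  "Obj terminal_cat = {undefined}" "Arr terminal_cat = {undefined}" "Dom terminal_cat f = undefined"
  "Cod terminal_cat f = undefined" "Ide terminal_cat x = undefined" "Comp terminal_cat g f = undefined"
  by (simp_all add: terminal_cat_def)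

lemma is_functor_const: "category A \<Longrightarrow> category B \<Longrightarrow> b \<in> Obj B \<Longrightarrow> is_functor A B (const_fctr B b)"
  by (auto simp: is_functor_def const_fctr_def cat_simps)

lemma category_copy:
  assumes C: "category C" and i: "inj i" and j: "inj j"
  shows "category (copy_cat i j C)"
  using C i j unfolding category_def copy_cat_def by (auto simp: inj_eq)

section \<open>Zigzags and transfer of 0-connectedness\<close>

lemma zigzag_refl: "(x, x) \<in> zigzag C"
  by (simp add: zigzag_def)

lemma zigzag_trans: "(x, y) \<in> zigzag C \<Longrightarrow> (y, z) \<in> zigzag C \<Longrightarrow> (x, z) \<in> zigzag C"
  unfolding zigzag_def by (rule rtrancl_trans)

lemma zigzag_sym: "(x, y) \<in> zigzag C \<Longrightarrow> (y, x) \<in> zigzag C"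
  unfolding zigzag_def
proof (rule symD[OF sym_rtrancl])
  show "sym ({(Dom C f, Cod C f) |f. f \<in> Arr C} \<union> {(Cod C f, Dom C f) |f. f \<in> Arr C})"
    by (auto simp: sym_def)
qed

lemma zigzag_arr: "f \<in> Arr C \<Longrightarrow> Dom C f = x \<Longrightarrow> Cod C f = y \<Longrightarrow> (x, y) \<in> zigzag C"
  unfolding zigzag_def by (rule r_into_rtrancl) blast

text \<open>A total space is connected if its base and fibres are: \<open>S x\<close> is the piece
  of \<open>H\<close> over the object \<open>x\<close> of \<open>G\<close>. Pieces may overlap, and
  a zigzag joining two points of a piece may leave it.\<close>

lemma zero_connected_cover:
  assumes G: "zero_connected G"
    and bounds: "\<And>f. f \<in> Arr G \<Longrightarrow> Dom G f \<in> Obj G \<and> Cod G f \<in> Obj G"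
    and S_sub: "\<And>x. x \<in> Obj G \<Longrightarrow> S x \<subseteq> Obj H"
    and S_ne: "\<And>x. x \<in> Obj G \<Longrightarrow> S x \<noteq> {}"
    and S_conn: "\<And>x s t. x \<in> Obj G \<Longrightarrow> s \<in> S x \<Longrightarrow> t \<in> S x \<Longrightarrow> (s, t) \<in> zigzag H"
    and S_arr: "\<And>f. f \<in> Arr G \<Longrightarrow> \<exists>s\<in>S (Dom G f). \<exists>t\<in>S (Cod G f). (s, t) \<in> zigzag H"
    and S_cov: "\<And>s. s \<in> Obj H \<Longrightarrow> \<exists>x\<in>Obj G. s \<in> S x"
  shows "zero_connected H"
proof -
  \<comment> \<open>One linked pair over an arrow is enough: both pieces are connected, so every
    pair over its ends is linked.\<close>
  have arr: "(s, t) \<in> zigzag H"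
    if f: "f \<in> Arr G" and s: "s \<in> S (Dom G f)" and t: "t \<in> S (Cod G f)" for f s t
  proof -
    obtain s' t' where "s' \<in> S (Dom G f)" "t' \<in> S (Cod G f)" "(s', t') \<in> zigzag H"
      using S_arr[OF f] by blast
    then have "(s, s') \<in> zigzag H" "(s', t') \<in> zigzag H" "(t', t) \<in> zigzag H"
      using bounds[OF f] S_conn s t by auto
    then show ?thesis by (blast intro: zigzag_trans)
  qed
  \<comment> \<open>Membership of \<open>y\<close> is carried through the induction because
    \<open>zigzag\<close> is a closure on the whole type, while a point of \<open>S y\<close> to
    pass through is available only over an object.\<close>
  have step: "y \<in> Obj G \<and> (\<forall>s\<in>S x. \<forall>t\<in>S y. (s, t) \<in> zigzag H)"
    if x: "x \<in> Obj G" and xy: "(x, y) \<in> zigzag G" for x y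
    using xy[unfolded zigzag_def]
  proof (induction rule: rtrancl_induct)
    case base
    then show ?case using x S_conn by auto
  next
    case (step y z)
    have z: "z \<in> Obj G" using step.hyps(2) bounds by auto
    have yz: "(s, t) \<in> zigzag H" if "s \<in> S y" "t \<in> S z" for s t
      using step.hyps(2) that by (auto intro: arr zigzag_sym[OF arr])
    obtain r where r: "r \<in> S y" using S_ne step.IH by blast
    have "(s, t) \<in> zigzag H" if "s \<in> S x" "t \<in> S z" for s t
      using zigzag_trans[of s r H t] step.IH r yz that by blast
    then show ?case using z by blast
  qed
  obtain x where x: "x \<in> Obj G" using G by (auto simp: zero_connected_def)
  have "Obj H \<noteq> {}" using S_ne[OF x] S_sub[OF x] by blast
  moreover have "(s, t) \<in> zigzag H" if "s \<in> Obj H" "t \<in> Obj H" for s t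
    using S_cov[OF that(1)] S_cov[OF that(2)] step G unfolding zero_connected_def by blast
  ultimately show ?thesis by (simp add: zero_connected_def)
qed

lemma zero_connected_hub:
  assumes "x \<in> Obj C" "\<And>y. y \<in> Obj C \<Longrightarrow> (x, y) \<in> zigzag C"
  shows "zero_connected C"
  using assms zigzag_trans[OF zigzag_sym] unfolding zero_connected_def by (metis empty_iff)

text \<open>The cover by singletons. Only a zigzag between the images of the ends of an arrow is
  asked for, so \<open>\<phi>\<close> may reverse arrows, as it does for opposite squares.\<close>

lemma zero_connected_image:
  assumes G: "zero_connected G"
    and bounds: "\<And>f. f \<in> Arr G \<Longrightarrow> Dom G f \<in> Obj G \<and> Cod G f \<in> Obj G"
    and ob: "\<And>x. x \<in> Obj G \<Longrightarrow> \<phi> x \<in> Obj H"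
    and ar: "\<And>f. f \<in> Arr G \<Longrightarrow> (\<phi> (Dom G f), \<phi> (Cod G f)) \<in> zigzag H"
    and surj: "\<And>y. y \<in> Obj H \<Longrightarrow> \<exists>x\<in>Obj G. y = \<phi> x"
  shows "zero_connected H"
  by (rule zero_connected_cover[OF G bounds, where S = "\<lambda>x. {\<phi> x}"])
    (use ob ar surj in \<open>auto simp: zigzag_refl\<close>)

section \<open>Squares\<close>

lemma squareD:
  assumes "is_square D"
  shows "category (TL D)" "category (TR D)" "category (BL D)" "category (BR D)"
    "is_functor (TL D) (TR D) (top_fctr D)" "is_functor (BL D) (BR D) (bottom_fctr D)"
    "is_functor (TL D) (BL D) (left_fctr D)" "is_functor (TR D) (BR D) (right_fctr D)"
  using assms by (auto simp: is_square_def)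

lemma square_cell:
  assumes "is_square D"
  shows "x \<in> Obj (TL D) \<Longrightarrow> two_cell D x \<in> Arr (BR D)"
    "x \<in> Obj (TL D) \<Longrightarrow> Dom (BR D) (two_cell D x) = ob (right_fctr D) (ob (top_fctr D) x)"
    "x \<in> Obj (TL D) \<Longrightarrow> Cod (BR D) (two_cell D x) = ob (bottom_fctr D) (ob (left_fctr D) x)"
    "f \<in> Arr (TL D) \<Longrightarrow> Comp (BR D) (two_cell D (Cod (TL D) f)) (ar (right_fctr D) (ar (top_fctr D) f)) =
       Comp (BR D) (ar (bottom_fctr D) (ar (left_fctr D) f)) (two_cell D (Dom (TL D) f))"
  using assms by (auto simp: is_square_def is_nat_trans_def)

lemmas square_simps = squareD(1-4) square_cell(1-3)
  fctr_simps[OF squareD(5)] fctr_simps[OF squareD(6)] fctr_simps[OF squareD(7)] fctr_simps[OF squareD(8)]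

lemma is_square_opp: "is_square D \<Longrightarrow> is_square (opp_square D)"
  unfolding is_square_def opp_square_def
  by (auto simp: category_opp is_functor_opp) (auto simp: is_nat_trans_def opp_cat_def)

lemma opp_square_opp [simp]: "opp_square (opp_square D) = D"
  by (simp add: opp_square_def)

lemma h_comp_simps [simp]:
  "TL (h_comp D D') = TL D'" "TR (h_comp D D') = TR D"
  "BL (h_comp D D') = BL D'" "BR (h_comp D D') = BR D"
  "top_fctr (h_comp D D') = comp_fctr (top_fctr D) (top_fctr D')"
  "bottom_fctr (h_comp D D') = comp_fctr (bottom_fctr D) (bottom_fctr D')"
  "left_fctr (h_comp D D') = left_fctr D'" "right_fctr (h_comp D D') = right_fctr D"
  "two_cell (h_comp D D') x =
     Comp (BR D) (ar (bottom_fctr D) (two_cell D' x)) (two_cell D (ob (top_fctr D') x))"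
  by (simp_all add: h_comp_def)

text \<open>Naturality of the pasted cell at \<open>f\<close> combines naturality of
  \<open>two_cell D\<close> at the image of \<open>f\<close> under \<open>top_fctr D'\<close> with
  the image under \<open>bottom_fctr D\<close> of naturality of \<open>two_cell D'\<close>; the rest
  is rebracketing.\<close>

lemma is_square_h_comp:
  assumes D: "is_square D" and D': "is_square D'" and c: "h_composable D D'"
  shows "is_square (h_comp D D')"
proof -
  have e [simp]: "TR D' = TL D" "BR D' = BL D" "right_fctr D' = left_fctr D"
    using c by (simp_all add: h_composable_def)
  note sD = squareD[OF D] and sD' = squareD[OF D', simplified]
  note nD = square_cell[OF D] and nD' = square_cell[OF D', simplified]
  note s = square_simps[OF D] square_simps[OF D', simplified] cat_simps
  have "is_nat_trans (TL D') (BR D) (comp_fctr (right_fctr D) (comp_fctr (top_fctr D) (top_fctr D')))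
      (comp_fctr (comp_fctr (bottom_fctr D) (bottom_fctr D')) (left_fctr D')) (two_cell (h_comp D D'))"
    unfolding is_nat_trans_def
  proof (intro conjI ballI)
    fix f assume f: "f \<in> Arr (TL D')"
    let ?B = "BR D" and ?x = "Dom (TL D') f" and ?y = "Cod (TL D') f"
    let ?w = "ar (bottom_fctr D)" and ?u = "ar (right_fctr D)" and ?v = "ar (top_fctr D)"
    let ?v' = "ar (top_fctr D')" and ?ov' = "ob (top_fctr D')"
    have xy: "?x \<in> Obj (TL D')" "?y \<in> Obj (TL D')" using f s by auto
    have "Comp ?B (Comp ?B (?w (two_cell D' ?y)) (two_cell D (?ov' ?y))) (?u (?v (?v' f))) =
          Comp ?B (?w (two_cell D' ?y)) (Comp ?B (two_cell D (?ov' ?y)) (?u (?v (?v' f))))"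
      using f xy by (intro cat_assoc) (auto simp: s)
    also have "Comp ?B (two_cell D (?ov' ?y)) (?u (?v (?v' f))) =
        Comp ?B (?w (ar (left_fctr D) (?v' f))) (two_cell D (?ov' ?x))"
      using nD(4)[of "?v' f"] f by (simp add: s)
    also have "Comp ?B (?w (two_cell D' ?y)) (Comp ?B (?w (ar (left_fctr D) (?v' f))) (two_cell D (?ov' ?x))) =
        Comp ?B (Comp ?B (?w (two_cell D' ?y)) (?w (ar (left_fctr D) (?v' f)))) (two_cell D (?ov' ?x))"
      using f xy by (intro cat_assoc[symmetric]) (auto simp: s)
    also have "Comp ?B (?w (two_cell D' ?y)) (?w (ar (left_fctr D) (?v' f))) =
        ?w (Comp (BL D) (two_cell D' ?y) (ar (left_fctr D) (?v' f)))"
      using f xy by (intro fctr_Comp[symmetric]) (auto simp: s sD)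
    also have "\<dots> = ?w (Comp (BL D) (ar (bottom_fctr D') (ar (left_fctr D') f)) (two_cell D' ?x))"
      using nD'(4)[OF f] by simp
    also have "\<dots> = Comp ?B (?w (ar (bottom_fctr D') (ar (left_fctr D') f))) (?w (two_cell D' ?x))"
      using f xy by (intro fctr_Comp) (auto simp: s sD)
    also have "Comp ?B \<dots> (two_cell D (?ov' ?x)) =
        Comp ?B (?w (ar (bottom_fctr D') (ar (left_fctr D') f)))
          (Comp ?B (?w (two_cell D' ?x)) (two_cell D (?ov' ?x)))"
      using f xy by (intro cat_assoc) (auto simp: s)
    finally show "Comp ?B (two_cell (h_comp D D') ?y)
        (ar (comp_fctr (right_fctr D) (comp_fctr (top_fctr D) (top_fctr D'))) f) =
      Comp ?B (ar (comp_fctr (comp_fctr (bottom_fctr D) (bottom_fctr D')) (left_fctr D')) f)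
        (two_cell (h_comp D D') ?x)" by simp
  qed (simp_all add: s)
  then show ?thesis
    using sD sD' by (simp add: is_square_def is_functor_comp[of _ "TL D"] is_functor_comp[of _ "BL D"])
qed

section \<open>Guitart exact squares\<close>

lemma guitart_Obj:
  "(a', f, g') \<in> Obj (guitart_cat D a b' g) \<longleftrightarrow>
     a' \<in> Obj (TL D) \<and> f \<in> Arr (TR D) \<and> Dom (TR D) f = a \<and> Cod (TR D) f = ob (top_fctr D) a' \<and>
     g' \<in> Arr (BL D) \<and> Dom (BL D) g' = ob (left_fctr D) a' \<and> Cod (BL D) g' = b' \<and>
     Comp (BR D) (ar (bottom_fctr D) g') (Comp (BR D) (two_cell D a') (ar (right_fctr D) f)) = g"
  by (simp add: guitart_cat_def Let_def)

lemma guitart_Arr: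
  "(x, f', y) \<in> Arr (guitart_cat D a b' g) \<longleftrightarrow>
     x \<in> Obj (guitart_cat D a b' g) \<and> y \<in> Obj (guitart_cat D a b' g) \<and>
     f' \<in> Arr (TL D) \<and> Dom (TL D) f' = fst x \<and> Cod (TL D) f' = fst y \<and>
     Comp (TR D) (ar (top_fctr D) f') (fst (snd x)) = fst (snd y) \<and>
     Comp (BL D) (snd (snd y)) (ar (left_fctr D) f') = snd (snd x)"
  by (cases x; cases y) (auto simp: guitart_cat_def Let_def)

lemma guitart_Dom [simp]: "Dom (guitart_cat D a b' g) (x, f', y) = x"
  and guitart_Cod [simp]: "Cod (guitart_cat D a b' g) (x, f', y) = y"
  by (simp_all add: guitart_cat_def Let_def)

lemma guitart_bounds:
  "k \<in> Arr (guitart_cat D a b' g) \<Longrightarrow>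
     Dom (guitart_cat D a b' g) k \<in> Obj (guitart_cat D a b' g) \<and>
     Cod (guitart_cat D a b' g) k \<in> Obj (guitart_cat D a b' g)"
  by (cases k) (auto simp: guitart_Arr)

lemma guitart_zigzagI:
  assumes "(a1, f1, g1) \<in> Obj (guitart_cat D a b' g)" "(a2, f2, g2) \<in> Obj (guitart_cat D a b' g)"
    "f' \<in> Arr (TL D)" "Dom (TL D) f' = a1" "Cod (TL D) f' = a2"
    "Comp (TR D) (ar (top_fctr D) f') f1 = f2" "Comp (BL D) g2 (ar (left_fctr D) f') = g1"
  shows "((a1, f1, g1), (a2, f2, g2)) \<in> zigzag (guitart_cat D a b' g)"
  by (rule zigzag_arr[where f = "((a1, f1, g1), f', (a2, f2, g2))"])
    (use assms in \<open>auto simp: guitart_Arr\<close>)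

section \<open>Exactness under opposites, composition and isomorphism\<close>

lemma guitart_exactI:
  assumes "is_square D"
    and "\<And>a b' g. a \<in> Obj (TR D) \<Longrightarrow> b' \<in> Obj (BL D) \<Longrightarrow> g \<in> Arr (BR D) \<Longrightarrow>
        Dom (BR D) g = ob (right_fctr D) a \<Longrightarrow> Cod (BR D) g = ob (bottom_fctr D) b' \<Longrightarrow>
        zero_connected (guitart_cat D a b' g)"
  shows "guitart_exact D"
  using assms by (auto simp: guitart_exact_def)

lemma guitart_exactD:
  assumes "guitart_exact D" "a \<in> Obj (TR D)" "b' \<in> Obj (BL D)" "g \<in> Arr (BR D)"
    "Dom (BR D) g = ob (right_fctr D) a" "Cod (BR D) g = ob (bottom_fctr D) b'"
  shows "zero_connected (guitart_cat D a b' g)"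
  using assms by (auto simp: guitart_exact_def)

lemma guitart_exact_square: "guitart_exact D \<Longrightarrow> is_square D"
  by (simp add: guitart_exact_def)

text \<open>Exchanging \<open>f\<close> and \<open>g'\<close> turns the Guitart category of
  \<open>D\<close> into the opposite of the one for \<open>opp_square D\<close>, and zigzags ignore
  the direction of arrows.\<close>

lemma guitart_exact_opp:
  assumes ex: "guitart_exact D"
  shows "guitart_exact (opp_square D)"
proof (rule guitart_exactI)
  have D: "is_square D" using ex by (rule guitart_exact_square)
  then show "is_square (opp_square D)" by (rule is_square_opp)
  note s = square_simps[OF D] cat_simps
  fix b a g
  assume "b \<in> Obj (TR (opp_square D))" "a \<in> Obj (BL (opp_square D))" "g \<in> Arr (BR (opp_square D))"
    "Dom (BR (opp_square D)) g = ob (right_fctr (opp_square D)) b"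
    "Cod (BR (opp_square D)) g = ob (bottom_fctr (opp_square D)) a"
  then have G: "zero_connected (guitart_cat D a b g)"
    by (intro guitart_exactD[OF ex]) (auto simp: opp_square_def opp_cat_def)
  \<comment> \<open>In the opposite square the threefold composite is bracketed the other
    way.\<close>
  have assoc: "Comp (BR D) (Comp (BR D) (ar (bottom_fctr D) g') (two_cell D a')) (ar (right_fctr D) f) =
      Comp (BR D) (ar (bottom_fctr D) g') (Comp (BR D) (two_cell D a') (ar (right_fctr D) f))"
    if "a' \<in> Obj (TL D)" "f \<in> Arr (TR D)" "Cod (TR D) f = ob (top_fctr D) a'" "g' \<in> Arr (BL D)"
      "Dom (BL D) g' = ob (left_fctr D) a'" for a' f g'
    using that by (intro cat_assoc) (simp_all add: s)
  have Obj: "(a', g', f) \<in> Obj (guitart_cat (opp_square D) b a g) \<longleftrightarrow>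
      (a', f, g') \<in> Obj (guitart_cat D a b g)" for a' f g'
    using assoc by (auto simp: guitart_Obj) (auto simp: opp_square_def opp_cat_def)
  show "zero_connected (guitart_cat (opp_square D) b a g)"
  proof (rule zero_connected_image[OF G guitart_bounds, where \<phi> = "\<lambda>(a', f, g'). (a', g', f)"])
    fix k assume k: "k \<in> Arr (guitart_cat D a b g)"
    obtain a1 f1 g1 h a2 f2 g2 where [simp]: "k = ((a1, f1, g1), h, (a2, f2, g2))" by (metis prod.exhaust)
    have "((a2, g2, f2), (a1, g1, f1)) \<in> zigzag (guitart_cat (opp_square D) b a g)"
      by (rule guitart_zigzagI[where f' = h])
        (use k in \<open>simp_all add: Obj guitart_Arr, simp_all add: opp_square_def opp_cat_def\<close>)
    then show "((\<lambda>(a', f, g'). (a', g', f)) (Dom (guitart_cat D a b g) k),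
        (\<lambda>(a', f, g'). (a', g', f)) (Cod (guitart_cat D a b g) k)) \<in> zigzag (guitart_cat (opp_square D) b a g)"
      by (simp add: zigzag_sym)
  next
    fix y assume y: "y \<in> Obj (guitart_cat (opp_square D) b a g)"
    then show "\<exists>x\<in>Obj (guitart_cat D a b g). y = (case x of (a', f, g') \<Rightarrow> (a', g', f))"
      using Obj by (cases y) force
  qed (auto simp: Obj)
qed

lemma guitart_exact_h_comp:
  assumes exD: "guitart_exact D" and exD': "guitart_exact D'" and c: "h_composable D D'"
  shows "guitart_exact (h_comp D D')"
proof (rule guitart_exactI)
  have D: "is_square D" and D': "is_square D'" using exD exD' by (simp_all add: guitart_exact_square)
  show "is_square (h_comp D D')" using D D' c by (rule is_square_h_comp)
  have e [simp]: "TR D' = TL D" "BR D' = BL D" "right_fctr D' = left_fctr D"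
    using c by (simp_all add: h_composable_def)
  note sD = squareD[OF D] and sD' = squareD[OF D', simplified]
  note nD = square_cell[OF D] and nD' = square_cell[OF D', simplified]
  note s = square_simps[OF D] square_simps[OF D', simplified] cat_simps
  fix a b g
  assume "a \<in> Obj (TR (h_comp D D'))" and "b \<in> Obj (BL (h_comp D D'))" and "g \<in> Arr (BR (h_comp D D'))"
    and "Dom (BR (h_comp D D')) g = ob (right_fctr (h_comp D D')) a"
    and "Cod (BR (h_comp D D')) g = ob (bottom_fctr (h_comp D D')) b"
  then have a: "a \<in> Obj (TR D)" and b: "b \<in> Obj (BL D')" and g: "g \<in> Arr (BR D)"
    "Dom (BR D) g = ob (right_fctr D) a" "Cod (BR D) g = ob (bottom_fctr D) (ob (bottom_fctr D') b)"
    by auto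
  let ?G = "guitart_cat D a (ob (bottom_fctr D') b) g"
  let ?H = "guitart_cat (h_comp D D') a b g"
  let ?v = "ar (top_fctr D)" and ?w = "ar (bottom_fctr D)" and ?u = "ar (right_fctr D)"
  let ?B = "BR D"
  have G: "zero_connected ?G"
    using a b g by (intro guitart_exactD[OF exD]) (auto simp: s)
  \<comment> \<open>\<open>S (a', f, g')\<close>: the objects of \<open>?H\<close> obtained by factoring \<open>g'\<close> through \<open>D'\<close>.  For an arrow of
      \<open>?G\<close>, each object over its target also lies over its source.\<close>
  define S where "S = (\<lambda>(a', f, g'). (\<lambda>(a'', f', g''). (a'', Comp (TR D) (?v f') f, g'')) `
      Obj (guitart_cat D' a' b g'))"
  have fib: "zero_connected (guitart_cat D' a' b g')" if "(a', f, g') \<in> Obj ?G" for a' f g'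
    using that b by (intro guitart_exactD[OF exD']) (auto simp: guitart_Obj)
  \<comment> \<open>Naturality of \<open>two_cell D\<close> at \<open>f'\<close> moves the 2-cell
    from v'(a'') back to \<open>a'\<close>; the equation defining an object of \<open>?H\<close>
    then splits into the one for \<open>D'\<close>, under w, and the one for
    \<open>D\<close>.\<close>
  have key: "Comp ?B (?w (ar (bottom_fctr D') g'')) (Comp ?B (Comp ?B (?w (two_cell D' a''))
        (two_cell D (ob (top_fctr D') a''))) (?u (Comp (TR D) (?v f') f))) =
      Comp ?B (?w (Comp (BL D) (ar (bottom_fctr D') g'') (Comp (BL D) (two_cell D' a'') (ar (left_fctr D) f'))))
        (Comp ?B (two_cell D a') (?u f))"
    if "a' \<in> Obj (TL D)" "f \<in> Arr (TR D)" "Cod (TR D) f = ob (top_fctr D) a'"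
      "a'' \<in> Obj (TL D')" "f' \<in> Arr (TL D)" "Dom (TL D) f' = a'" "Cod (TL D) f' = ob (top_fctr D') a''"
      "g'' \<in> Arr (BL D')" "Dom (BL D') g'' = ob (left_fctr D') a''" for a' f a'' f' g''
  proof -
    have "Comp ?B (two_cell D (ob (top_fctr D') a'')) (Comp ?B (?u (?v f')) (?u f)) =
       Comp ?B (Comp ?B (two_cell D (ob (top_fctr D') a'')) (?u (?v f'))) (?u f)"
      using that by (intro cat_assoc[symmetric]) (auto simp: s)
    also have "\<dots> = Comp ?B (Comp ?B (?w (ar (left_fctr D) f')) (two_cell D a')) (?u f)"
      using that nD(4)[of f'] by simp
    finally show ?thesis
      using that by (simp add: s cat_assoc)
  qed
  have S_sub: "(a'', Comp (TR D) (?v f') f, g'') \<in> Obj ?H"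
    if "(a', f, g') \<in> Obj ?G" "(a'', f', g'') \<in> Obj (guitart_cat D' a' b g')" for a' f g' a'' f' g''
    using that key[of a' f a'' f' g''] by (auto simp: guitart_Obj s)
  show "zero_connected ?H"
  proof (rule zero_connected_cover[OF G guitart_bounds, where S = S])
    fix x assume x: "x \<in> Obj ?G"
    obtain a' f g' where [simp]: "x = (a', f, g')" by (metis prod.exhaust)
    show "S x \<subseteq> Obj ?H" using x S_sub by (auto simp: S_def)
    show "S x \<noteq> {}" using x fib by (auto simp: S_def zero_connected_def)
    fix r t assume rt: "r \<in> S x" "t \<in> S x"
    have "zero_connected (guitart_cat D' a' b g')" using fib x by simp
    \<comment> \<open>\<open>zigzag\<close> depends only on the arrows, so this record, with
      \<open>S x\<close> as its objects, has the zigzags of \<open>?H\<close>;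
      \<open>zero_connected_image\<close> can thus be aimed at the piece alone.\<close>
    then have "zero_connected \<lparr>Obj = S x, Arr = Arr ?H, Dom = Dom ?H, Cod = Cod ?H, Ide = Ide ?H, Comp = Comp ?H\<rparr>"
    proof (rule zero_connected_image[OF _ guitart_bounds,
          where \<phi> = "\<lambda>(a'', f', g''). (a'', Comp (TR D) (?v f') f, g'')"])
      fix k assume k: "k \<in> Arr (guitart_cat D' a' b g')"
      obtain a1 f1 g1 h a2 f2 g2 where [simp]: "k = ((a1, f1, g1), h, (a2, f2, g2))" by (metis prod.exhaust)
      have h: "h \<in> Arr (TL D')" "Dom (TL D') h = a1" "Cod (TL D') h = a2" "f1 \<in> Arr (TL D)"
        "Dom (TL D) f1 = a'" "Cod (TL D) f1 = ob (top_fctr D') a1"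
        using k by (auto simp: guitart_Arr guitart_Obj)
      have f: "f \<in> Arr (TR D)" "Cod (TR D) f = ob (top_fctr D) a'"
        using x by (auto simp: guitart_Obj)
      have "((a1, Comp (TR D) (?v f1) f, g1), (a2, Comp (TR D) (?v f2) f, g2)) \<in> zigzag ?H"
      proof (rule guitart_zigzagI[where f' = h])
        have "Comp (TR D) (?v (Comp (TL D) (ar (top_fctr D') h) f1)) f =
          Comp (TR D) (?v (ar (top_fctr D') h)) (Comp (TR D) (?v f1) f)"
          using h f by (simp add: s cat_assoc)
        then show "Comp (TR (h_comp D D')) (ar (top_fctr (h_comp D D')) h) (Comp (TR D) (?v f1) f) =
          Comp (TR D) (?v f2) f"
          using k by (auto simp: guitart_Arr)
      qed (use k x S_sub in \<open>auto simp: guitart_Arr\<close>)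
      then show "((\<lambda>(a'', f', g''). (a'', Comp (TR D) (?v f') f, g'')) (Dom (guitart_cat D' a' b g') k),
        (\<lambda>(a'', f', g''). (a'', Comp (TR D) (?v f') f, g'')) (Cod (guitart_cat D' a' b g') k))
        \<in> zigzag \<lparr>Obj = S x, Arr = Arr ?H, Dom = Dom ?H, Cod = Cod ?H, Ide = Ide ?H, Comp = Comp ?H\<rparr>"
        by (simp add: zigzag_def)
    qed (auto simp: S_def, force)
    then show "(r, t) \<in> zigzag ?H" using rt by (simp add: zero_connected_def zigzag_def)
  next
    fix k assume k: "k \<in> Arr ?G"
    obtain a1 f1 g1 h a2 f2 g2 where [simp]: "k = ((a1, f1, g1), h, (a2, f2, g2))" by (metis prod.exhaust)
    have "(a2, f2, g2) \<in> Obj ?G" using k by (simp add: guitart_Arr)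
    from fib[OF this] obtain a'' f' g'' where o: "(a'', f', g'') \<in> Obj (guitart_cat D' a2 b g2)"
      unfolding zero_connected_def by auto
    have c: "Comp (TR D) (?v (Comp (TL D) f' h)) f1 = Comp (TR D) (?v f') f2"
      using k o by (auto simp: guitart_Arr guitart_Obj s cat_assoc)
    have o1: "(a'', Comp (TL D) f' h, g'') \<in> Obj (guitart_cat D' a1 b g1)"
      using k o by (auto simp: guitart_Arr guitart_Obj s cat_assoc)
    have "(a'', Comp (TR D) (?v f') f2, g'') \<in> S (a1, f1, g1)"
      unfolding S_def using o1 c by force
    moreover have "(a'', Comp (TR D) (?v f') f2, g'') \<in> S (a2, f2, g2)"
      unfolding S_def using o by force
    ultimately show "\<exists>r\<in>S (Dom ?G k). \<exists>t\<in>S (Cod ?G k). (r, t) \<in> zigzag ?H"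
      using zigzag_refl by fastforce
  next
    fix y assume y: "y \<in> Obj ?H"
    obtain a'' f g'' where [simp]: "y = (a'', f, g'')" by (metis prod.exhaust)
    \<comment> \<open>The canonical factorization: v'(a'') is the intermediate object, the 2-cell of
      \<open>D'\<close> is absorbed into the second arrow, and the arrow of A' is an
      identity.\<close>
    let ?a = "ob (top_fctr D') a''" and ?g = "Comp (BL D) (ar (bottom_fctr D') g'') (two_cell D' a'')"
    have 1: "(?a, f, ?g) \<in> Obj ?G"
      using y by (auto simp: guitart_Obj s cat_assoc)
    have 2: "(a'', Ide (TL D) ?a, g'') \<in> Obj (guitart_cat D' ?a b ?g)"
      using y by (auto simp: guitart_Obj s)
    have "Comp (TR D) (?v (Ide (TL D) ?a)) f = f"
      using y by (auto simp: guitart_Obj s)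
    then have "y \<in> S (?a, f, ?g)" unfolding S_def using 2 by force
    then show "\<exists>x\<in>Obj ?G. y \<in> S x" using 1 by blast
  qed
qed

lemma guitart_exact_iso:
  assumes ex: "guitart_exact D" and iso: "iso_square D E"
  shows "guitart_exact E"
proof (rule guitart_exactI)
  have D: "is_square D" using ex by (rule guitart_exact_square)
  show E: "is_square E" using iso by (simp add: iso_square_def)
  obtain TLi TRi BLi BRi where
    i: "is_iso_fctr (TL D) (TL E) TLi" "is_iso_fctr (TR D) (TR E) TRi"
       "is_iso_fctr (BL D) (BL E) BLi" "is_iso_fctr (BR D) (BR E) BRi"
    and eqs: "eq_fctr (TL D) (comp_fctr (top_fctr E) TLi) (comp_fctr TRi (top_fctr D))"
      "eq_fctr (BL D) (comp_fctr (bottom_fctr E) BLi) (comp_fctr BRi (bottom_fctr D))"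
      "eq_fctr (TL D) (comp_fctr (left_fctr E) TLi) (comp_fctr BLi (left_fctr D))"
      "eq_fctr (TR D) (comp_fctr (right_fctr E) TRi) (comp_fctr BRi (right_fctr D))"
      "\<And>x. x \<in> Obj (TL D) \<Longrightarrow> two_cell E (ob TLi x) = ar BRi (two_cell D x)"
    using iso unfolding iso_square_def by blast
  have q: "x \<in> Obj (TL D) \<Longrightarrow> ob (top_fctr E) (ob TLi x) = ob TRi (ob (top_fctr D) x)"
    "f \<in> Arr (TL D) \<Longrightarrow> ar (top_fctr E) (ar TLi f) = ar TRi (ar (top_fctr D) f)"
    "x \<in> Obj (TL D) \<Longrightarrow> ob (left_fctr E) (ob TLi x) = ob BLi (ob (left_fctr D) x)"
    "f \<in> Arr (TL D) \<Longrightarrow> ar (left_fctr E) (ar TLi f) = ar BLi (ar (left_fctr D) f)"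
    "x \<in> Obj (BL D) \<Longrightarrow> ob (bottom_fctr E) (ob BLi x) = ob BRi (ob (bottom_fctr D) x)"
    "f \<in> Arr (BL D) \<Longrightarrow> ar (bottom_fctr E) (ar BLi f) = ar BRi (ar (bottom_fctr D) f)"
    "x \<in> Obj (TR D) \<Longrightarrow> ob (right_fctr E) (ob TRi x) = ob BRi (ob (right_fctr D) x)"
    "f \<in> Arr (TR D) \<Longrightarrow> ar (right_fctr E) (ar TRi f) = ar BRi (ar (right_fctr D) f)" for x f
    using eqs by (simp_all add: eq_fctr_def)
  note iF = i[THEN iso_fctr_functor]
  note inj = i[THEN iso_fctr_ob_inj] i[THEN iso_fctr_ar_inj]
  note sF = fctr_simps[OF iF(1)] fctr_simps[OF iF(2)] fctr_simps[OF iF(3)] fctr_simps[OF iF(4)]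
  note s = square_simps[OF D] cat_simps
  fix a b g
  assume "a \<in> Obj (TR E)" "b \<in> Obj (BL E)" "g \<in> Arr (BR E)"
    and dc: "Dom (BR E) g = ob (right_fctr E) a" "Cod (BR E) g = ob (bottom_fctr E) b"
  then obtain a0 b0 g0 where a0: "a0 \<in> Obj (TR D)" "a = ob TRi a0" and b0: "b0 \<in> Obj (BL D)" "b = ob BLi b0"
    and g0: "g0 \<in> Arr (BR D)" "g = ar BRi g0"
    using iso_fctr_ob_surj[OF i(2)] iso_fctr_ob_surj[OF i(3)] iso_fctr_ar_surj[OF i(4)] by blast
  have G: "zero_connected (guitart_cat D a0 b0 g0)"
    using a0 b0 g0 dc by (intro guitart_exactD[OF ex]) (simp_all add: q s sF inj)
  let ?\<phi> = "\<lambda>(a', f, g'). (ob TLi a', ar TRi f, ar BLi g')"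
  have Obj: "(ob TLi a', ar TRi f, ar BLi g') \<in> Obj (guitart_cat E a b g) \<longleftrightarrow>
      (a', f, g') \<in> Obj (guitart_cat D a0 b0 g0)"
    if mem: "a' \<in> Obj (TL D)" "f \<in> Arr (TR D)" "g' \<in> Arr (BL D)" for a' f g'
  \<comment> \<open>The equation between composites can be transported only when the arrows are
    composable; with wrong ends neither triple is an object.\<close>
  proof (cases "Cod (TR D) f = ob (top_fctr D) a' \<and> Dom (BL D) g' = ob (left_fctr D) a'")
    case True
    have "Comp (BR E) (ar (bottom_fctr E) (ar BLi g')) (Comp (BR E) (two_cell E (ob TLi a'))
        (ar (right_fctr E) (ar TRi f))) =
      ar BRi (Comp (BR D) (ar (bottom_fctr D) g') (Comp (BR D) (two_cell D a') (ar (right_fctr D) f)))"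
      using True mem by (simp add: s sF q eqs(5))
    then have "Comp (BR E) (ar (bottom_fctr E) (ar BLi g')) (Comp (BR E) (two_cell E (ob TLi a'))
        (ar (right_fctr E) (ar TRi f))) = g \<longleftrightarrow>
      Comp (BR D) (ar (bottom_fctr D) g') (Comp (BR D) (two_cell D a') (ar (right_fctr D) f)) = g0"
      unfolding g0(2) using True mem g0(1) by (simp only: iso_fctr_ar_inj[OF i(4)] s)
    \<comment> \<open>Of the rules for the four isomorphisms, those for identities and composites
      are left out, as is compatibility on arrows, so that the equivalence just proved still
      matches.\<close>
    then show ?thesis
      unfolding guitart_Obj using True mem a0 b0 by (auto simp: s sF(1-4,7-10,13-16,19-22) q(1,3) inj)
  next
    case False
    then show ?thesis using mem by (auto simp: guitart_Obj s sF q inj)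
  qed
  show "zero_connected (guitart_cat E a b g)"
  proof (rule zero_connected_image[OF G guitart_bounds, where \<phi> = ?\<phi>])
    fix x assume "x \<in> Obj (guitart_cat D a0 b0 g0)"
    then show "?\<phi> x \<in> Obj (guitart_cat E a b g)"
      using Obj by (cases x) (auto simp: guitart_Obj)
  next
    fix k assume k: "k \<in> Arr (guitart_cat D a0 b0 g0)"
    obtain a1 f1 g1 h a2 f2 g2 where [simp]: "k = ((a1, f1, g1), h, (a2, f2, g2))" by (metis prod.exhaust)
    have h: "h \<in> Arr (TL D)" "Dom (TL D) h = a1" "Cod (TL D) h = a2"
      "(a1, f1, g1) \<in> Obj (guitart_cat D a0 b0 g0)" "(a2, f2, g2) \<in> Obj (guitart_cat D a0 b0 g0)"
      and h': "Comp (TR D) (ar (top_fctr D) h) f1 = f2" "Comp (BL D) g2 (ar (left_fctr D) h) = g1"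
      using k by (auto simp: guitart_Arr)
    have o: "a1 \<in> Obj (TL D)" "f1 \<in> Arr (TR D)" "g1 \<in> Arr (BL D)"
      "a2 \<in> Obj (TL D)" "f2 \<in> Arr (TR D)" "g2 \<in> Arr (BL D)"
      "Cod (TR D) f1 = ob (top_fctr D) a1" "Dom (BL D) g2 = ob (left_fctr D) a2"
      using h by (auto simp: guitart_Obj)
    have "((ob TLi a1, ar TRi f1, ar BLi g1), (ob TLi a2, ar TRi f2, ar BLi g2)) \<in> zigzag (guitart_cat E a b g)"
    proof (rule guitart_zigzagI[where f' = "ar TLi h"])
      show "Comp (TR E) (ar (top_fctr E) (ar TLi h)) (ar TRi f1) = ar TRi f2"
        using h o unfolding h'(1)[symmetric] by (simp add: s sF q)
      show "Comp (BL E) (ar BLi g2) (ar (left_fctr E) (ar TLi h)) = ar BLi g1"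
        using h o unfolding h'(2)[symmetric] by (simp add: s sF q)
    qed (use h o Obj in \<open>simp_all add: s sF\<close>)
    then show "(?\<phi> (Dom (guitart_cat D a0 b0 g0) k), ?\<phi> (Cod (guitart_cat D a0 b0 g0) k))
        \<in> zigzag (guitart_cat E a b g)"
      by simp
  next
    fix y assume y: "y \<in> Obj (guitart_cat E a b g)"
    obtain x1 x2 x3 where y': "y = (x1, x2, x3)" by (metis prod.exhaust)
    obtain a' f g' where x: "a' \<in> Obj (TL D)" "f \<in> Arr (TR D)" "g' \<in> Arr (BL D)"
      "y = (ob TLi a', ar TRi f, ar BLi g')"
      using y iso_fctr_ob_surj[OF i(1), of x1] iso_fctr_ar_surj[OF i(2), of x2] iso_fctr_ar_surj[OF i(3), of x3]
      unfolding y' by (auto simp: guitart_Obj)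
    then have "(a', f, g') \<in> Obj (guitart_cat D a0 b0 g0)" using y Obj by simp
    then show "\<exists>x\<in>Obj (guitart_cat D a0 b0 g0). y = ?\<phi> x"
      using x(4) by (intro bexI[of _ "(a', f, g')"]) auto
  qed
qed

section \<open>Comma squares and their exactness\<close>

lemma comma_square_Obj:
  assumes D: "comma_square D" and "a \<in> Obj (TR D)" "b' \<in> Obj (BL D)" "g \<in> Arr (BR D)"
    "Dom (BR D) g = ob (right_fctr D) a" "Cod (BR D) g = ob (bottom_fctr D) b'"
  obtains x where "x \<in> Obj (TL D)" "ob (top_fctr D) x = a" "ob (left_fctr D) x = b'" "two_cell D x = g"
proof -
  have iso: "is_iso_fctr (TL D) (comma_cat (TR D) (BL D) (BR D) (right_fctr D) (bottom_fctr D)) (comma_comparison D)"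
    using D by (simp add: comma_square_def)
  have "(a, b', g) \<in> Obj (comma_cat (TR D) (BL D) (BR D) (right_fctr D) (bottom_fctr D))"
    using assms(2-) by (simp add: comma_cat_def Let_def)
  then obtain x where "x \<in> Obj (TL D)" "(a, b', g) = ob (comma_comparison D) x"
    using iso_fctr_ob_surj[OF iso] by blast
  then show thesis
    using that by (simp add: comma_comparison_def Let_def)
qed

text \<open>Surjectivity of the comparison on arrows gives an \<open>h\<close> with the right image;
  injectivity on objects then identifies its ends with \<open>x\<close> and
  \<open>y\<close>.\<close>

lemma comma_square_Arr:
  assumes D: "comma_square D" and xy: "x \<in> Obj (TL D)" "y \<in> Obj (TL D)"
    and "f \<in> Arr (TR D)" "Dom (TR D) f = ob (top_fctr D) x" "Cod (TR D) f = ob (top_fctr D) y"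
    and "g' \<in> Arr (BL D)" "Dom (BL D) g' = ob (left_fctr D) x" "Cod (BL D) g' = ob (left_fctr D) y"
    and "Comp (BR D) (two_cell D y) (ar (right_fctr D) f) = Comp (BR D) (ar (bottom_fctr D) g') (two_cell D x)"
  obtains h where "h \<in> Arr (TL D)" "Dom (TL D) h = x" "Cod (TL D) h = y"
    "ar (top_fctr D) h = f" "ar (left_fctr D) h = g'"
proof -
  let ?K = "comma_comparison D"
  have sq: "is_square D" and iso: "is_iso_fctr (TL D) (comma_cat (TR D) (BL D) (BR D) (right_fctr D) (bottom_fctr D)) ?K"
    using D by (simp_all add: comma_square_def)
  have "(ob ?K x, (f, g'), ob ?K y) \<in> Arr (comma_cat (TR D) (BL D) (BR D) (right_fctr D) (bottom_fctr D))"
    using assms(2-) square_simps[OF sq] by (auto simp: comma_cat_def comma_comparison_def Let_def)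
  then obtain h where h: "h \<in> Arr (TL D)" "(ob ?K x, (f, g'), ob ?K y) = ar ?K h"
    using iso_fctr_ar_surj[OF iso] by blast
  have "ar ?K h = (ob ?K (Dom (TL D) h), (ar (top_fctr D) h, ar (left_fctr D) h), ob ?K (Cod (TL D) h))"
    by (simp add: comma_comparison_def Let_def)
  then have K: "ob ?K (Dom (TL D) h) = ob ?K x" "ob ?K (Cod (TL D) h) = ob ?K y"
    and tl: "ar (top_fctr D) h = f" "ar (left_fctr D) h = g'"
    using h(2) by (simp_all only: prod.inject)
  note cat = squareD(1)[OF sq]
  have "Dom (TL D) h = x" "Cod (TL D) h = y"
    using K iso_fctr_ob_inj[OF iso] cat_Dom[OF cat h(1)] cat_Cod[OF cat h(1)] xy by blast+
  then show thesis using h(1) tl by (intro that)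
qed

text \<open>The object of A' that stands for \<open>g\<close> itself, taken with two identities, is
  a hub. An arrow between it and a general object need not exist in either direction, so zigzags of
  length two are used.\<close>

lemma guitart_exact_comma:
  assumes D: "comma_square D"
  shows "guitart_exact D"
proof (rule guitart_exactI)
  show sq: "is_square D" using D by (simp add: comma_square_def)
  note s = square_simps[OF sq] cat_simps
  fix a b g
  assume a: "a \<in> Obj (TR D)" and b: "b \<in> Obj (BL D)" and g: "g \<in> Arr (BR D)"
    "Dom (BR D) g = ob (right_fctr D) a" "Cod (BR D) g = ob (bottom_fctr D) b"
  let ?G = "guitart_cat D a b g"
  obtain z where z: "z \<in> Obj (TL D)" "ob (top_fctr D) z = a" "ob (left_fctr D) z = b" "two_cell D z = g"
    using comma_square_Obj[OF D a b g] by blast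
  have zO: "(z, Ide (TR D) a, Ide (BL D) b) \<in> Obj ?G"
    using a b g z by (simp add: guitart_Obj s)
  show "zero_connected ?G"
  proof (rule zero_connected_hub[OF zO])
    fix q assume q: "q \<in> Obj ?G"
    obtain a' f g' where [simp]: "q = (a', f, g')" by (metis prod.exhaust)
    have o: "a' \<in> Obj (TL D)" "f \<in> Arr (TR D)" "Dom (TR D) f = a" "Cod (TR D) f = ob (top_fctr D) a'"
      "g' \<in> Arr (BL D)" "Dom (BL D) g' = ob (left_fctr D) a'" "Cod (BL D) g' = b"
      "Comp (BR D) (ar (bottom_fctr D) g') (Comp (BR D) (two_cell D a') (ar (right_fctr D) f)) = g"
      using q by (simp_all add: guitart_Obj)
    \<comment> \<open>\<open>m\<close> lies over \<open>(a, u'(a'), \<alpha> u(f))\<close>: \<open>(id, g')\<close> maps it to \<open>z\<close> and \<open>(f, id)\<close> maps it to \<open>a'\<close>.\<close>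
    obtain m where m: "m \<in> Obj (TL D)" "ob (top_fctr D) m = a" "ob (left_fctr D) m = ob (left_fctr D) a'"
      "two_cell D m = Comp (BR D) (two_cell D a') (ar (right_fctr D) f)"
      by (rule comma_square_Obj[OF D a, of "ob (left_fctr D) a'"
            "Comp (BR D) (two_cell D a') (ar (right_fctr D) f)"]) (use o a in \<open>simp_all add: s\<close>)
    have mO: "(m, Ide (TR D) a, g') \<in> Obj ?G"
      using o m a by (simp add: guitart_Obj s)
    obtain h where h: "h \<in> Arr (TL D)" "Dom (TL D) h = m" "Cod (TL D) h = z"
      "ar (top_fctr D) h = Ide (TR D) a" "ar (left_fctr D) h = g'"
      by (rule comma_square_Arr[OF D m(1) z(1), of "Ide (TR D) a" g']) (use o m z a b g in \<open>simp_all add: s\<close>)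
    obtain k where k: "k \<in> Arr (TL D)" "Dom (TL D) k = m" "Cod (TL D) k = a'"
      "ar (top_fctr D) k = f" "ar (left_fctr D) k = Ide (BL D) (ob (left_fctr D) a')"
      by (rule comma_square_Arr[OF D m(1) o(1), of f "Ide (BL D) (ob (left_fctr D) a')"])
        (use o m a in \<open>simp_all add: s\<close>)
    have "((m, Ide (TR D) a, g'), (z, Ide (TR D) a, Ide (BL D) b)) \<in> zigzag ?G"
      by (rule guitart_zigzagI[OF mO zO h(1-3)]) (use h o a in \<open>simp_all add: s\<close>)
    moreover have "((m, Ide (TR D) a, g'), q) \<in> zigzag ?G"
      unfolding \<open>q = (a', f, g')\<close>
      by (rule guitart_zigzagI[OF mO _ k(1-3)]) (use k o a q in \<open>simp_all add: s\<close>)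
    ultimately show "((z, Ide (TR D) a, Ide (BL D) b), q) \<in> zigzag ?G"
      by (blast intro: zigzag_sym zigzag_trans)
  qed
qed

section \<open>Slice squares and local descent\<close>

lemma slice_Obj:
  "(a, g) \<in> Obj (slice_cat A B u b) \<longleftrightarrow> a \<in> Obj A \<and> g \<in> Arr B \<and> Dom B g = ob u a \<and> Cod B g = b"
  by (simp add: slice_cat_def Let_def)

lemma slice_Arr:
  "(x, f, y) \<in> Arr (slice_cat A B u b) \<longleftrightarrow>
     x \<in> Obj (slice_cat A B u b) \<and> y \<in> Obj (slice_cat A B u b) \<and>
     f \<in> Arr A \<and> Dom A f = fst x \<and> Cod A f = fst y \<and> Comp B (snd y) (ar u f) = snd x"
  by (cases x; cases y) (auto simp: slice_cat_def Let_def)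

lemma slice_simps [simp]:
  "Dom (slice_cat A B u b) (x, f, y) = x" "Cod (slice_cat A B u b) (x, f, y) = y"
  "Ide (slice_cat A B u b) x = (x, Ide A (fst x), x)"
  "Comp (slice_cat A B u b) (y', k, z) (x, f, y) = (x, Comp A k f, z)"
  by (simp_all add: slice_cat_def Let_def split: prod.splits)

lemma category_slice:
  assumes A: "category A" and B: "category B" and u: "is_functor A B u"
  shows "category (slice_cat A B u b)"
proof -
  note s = A B cat_simps fctr_simps[OF u]
  let ?S = "slice_cat A B u b"
  have cmp: "Comp B (snd z) (ar u (Comp A k f)) = snd x"
    if "(x, f, y) \<in> Arr ?S" "(y, k, z) \<in> Arr ?S" for x y z f k
    using that by (cases x; cases y; cases z) (auto simp: slice_Arr slice_Obj s cat_assoc[symmetric])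
  show ?thesis
    unfolding category_def
  proof (intro conjI ballI impI)
    fix k l assume kl: "k \<in> Arr ?S" "l \<in> Arr ?S" "Cod ?S k = Dom ?S l"
    obtain x f y where k: "k = (x, f, y)" by (metis prod.exhaust)
    obtain h z where l: "l = (y, h, z)" using kl(3) unfolding k by (metis slice_simps(1,2) prod.exhaust)
    show "Comp ?S l k \<in> Arr ?S"
      using kl cmp[of x f y h z] unfolding k l by (auto simp: slice_Arr s)
    show "Dom ?S (Comp ?S l k) = Dom ?S k" "Cod ?S (Comp ?S l k) = Cod ?S l"
      unfolding k l by simp_all
  next
    fix k l m assume m: "k \<in> Arr ?S" "l \<in> Arr ?S" "m \<in> Arr ?S" "Cod ?S k = Dom ?S l \<and> Cod ?S l = Dom ?S m"
    obtain x f y h z h' z' where klm: "k = (x, f, y)" "l = (y, h, z)" "m = (z, h', z')"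
      using m(4) by (cases k; cases l; cases m) auto
    show "Comp ?S m (Comp ?S l k) = Comp ?S (Comp ?S m l) k"
      using m(1-3) unfolding klm by (auto simp: slice_Arr s cat_assoc)
  qed (auto simp: slice_Arr slice_Obj s)
qed

lemma inj_slice_arr_code: "inj slice_arr_code"
  by (rule injI) (auto simp: slice_arr_code_def inj_eq[OF inj_pair_code])

text \<open>Stated at coded arguments, where the \<open>inv\<close> of the definition can be
  evaluated; all objects and arrows of the coded slice have this form.\<close>

lemma slice_square_simps [simp]:
  "TR (slice_square A B u b) = A" "BL (slice_square A B u b) = terminal_cat" "BR (slice_square A B u b) = B"
  "bottom_fctr (slice_square A B u b) = const_fctr B b"
  "left_fctr (slice_square A B u b) = const_fctr terminal_cat undefined"
  "right_fctr (slice_square A B u b) = u"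
  "Obj (TL (slice_square A B u b)) = pair_code ` Obj (slice_cat A B u b)"
  "Arr (TL (slice_square A B u b)) = slice_arr_code ` Arr (slice_cat A B u b)"
  "Dom (TL (slice_square A B u b)) (slice_arr_code (x, f, y)) = pair_code x"
  "Cod (TL (slice_square A B u b)) (slice_arr_code (x, f, y)) = pair_code y"
  "ob (top_fctr (slice_square A B u b)) (pair_code (a, g)) = a"
  "ar (top_fctr (slice_square A B u b)) (slice_arr_code (x, f, y)) = f"
  "two_cell (slice_square A B u b) (pair_code (a, g)) = g"
  by (simp_all add: slice_square_def copy_cat_def inv_f_f inj_pair_code inj_slice_arr_code)

lemma const_fctr_simps [simp]: "ob (const_fctr B b) x = b" "ar (const_fctr B b) f = Ide B b"
  by (simp_all add: const_fctr_def)

lemma is_square_slice: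
  assumes A: "category A" and B: "category B" and u: "is_functor A B u" and b: "b \<in> Obj B"
  shows "is_square (slice_square A B u b)"
proof -
  let ?S = "slice_square A B u b"
  note s = A B b cat_simps fctr_simps[OF u]
  have TL: "category (TL ?S)"
    unfolding slice_square_def
    by (simp add: category_copy category_slice[OF A B u] inj_pair_code inj_slice_arr_code)
  moreover have "is_functor (TL ?S) A (top_fctr ?S)"
    unfolding is_functor_def
    by (auto simp: slice_Obj slice_Arr)
      (auto simp: slice_square_def copy_cat_def slice_Obj inv_f_f inj_pair_code inj_slice_arr_code)
  moreover have "is_nat_trans (TL ?S) B (comp_fctr u (top_fctr ?S))
      (comp_fctr (const_fctr B b) (const_fctr terminal_cat undefined)) (two_cell ?S)"
    unfolding is_nat_trans_def by (auto simp: slice_Obj slice_Arr s)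
  ultimately show ?thesis
    using assms by (simp add: is_square_def is_functor_const category_terminal)
qed

text \<open>Up to coding this is a comma square, but over e one arrow is enough: since e has only an
  identity, the hub given by \<open>g\<close> and the identity of \<open>a\<close> maps to every
  object, along the component \<open>f\<close> of that object.\<close>

lemma guitart_exact_slice:
  assumes A: "category A" and B: "category B" and u: "is_functor A B u" and b: "b \<in> Obj B"
  shows "guitart_exact (slice_square A B u b)"
proof (rule guitart_exactI)
  let ?S = "slice_square A B u b"
  show "is_square ?S" using assms by (rule is_square_slice)
  note s = A B b cat_simps fctr_simps[OF u]
  fix a c g
  assume "a \<in> Obj (TR ?S)" "c \<in> Obj (BL ?S)" "g \<in> Arr (BR ?S)"
    "Dom (BR ?S) g = ob (right_fctr ?S) a" "Cod (BR ?S) g = ob (bottom_fctr ?S) c"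
  then have a: "a \<in> Obj A" "c = undefined" "g \<in> Arr B" "Dom B g = ob u a" "Cod B g = b" by auto
  let ?G = "guitart_cat ?S a c g"
  have x: "(pair_code (a, g), Ide A a, undefined) \<in> Obj ?G"
    using a by (simp add: guitart_Obj slice_Obj s)
  show "zero_connected ?G"
  proof (rule zero_connected_hub[OF x])
    fix q assume q: "q \<in> Obj ?G"
    then obtain a' g' f where [simp]: "q = (pair_code (a', g'), f, undefined)"
      by (cases q) (auto simp: guitart_Obj slice_Obj)
    have o: "(a', g') \<in> Obj (slice_cat A B u b)" "f \<in> Arr A" "Dom A f = a" "Cod A f = a'"
      "Comp B g' (ar u f) = g"
      using q by (auto simp: guitart_Obj inj_eq[OF inj_pair_code] slice_Obj s)
    show "((pair_code (a, g), Ide A a, undefined), q) \<in> zigzag ?G"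
      unfolding \<open>q = _\<close>
      by (rule guitart_zigzagI[OF x, where f' = "slice_arr_code ((a, g), f, (a', g'))"])
        (use o q a in \<open>auto simp: slice_Arr slice_Obj s\<close>)
  qed
qed

lemma h_composable_slice: "h_composable D (slice_square (TL D) (BL D) (left_fctr D) b)"
  by (simp add: h_composable_def)

lemma guitart_exact_h_comp_slice:
  assumes D: "guitart_exact D" and b: "b \<in> Obj (BL D)"
  shows "guitart_exact (h_comp D (slice_square (TL D) (BL D) (left_fctr D) b))"
  using squareD[OF guitart_exact_square[OF D]] b
  by (intro guitart_exact_h_comp D h_composable_slice guitart_exact_slice)

text \<open>The Guitart category of the composite at \<open>(a, undefined, g)\<close> is a coded
  copy of the one for \<open>D\<close> at \<open>(a, b, g)\<close>: the slice records
  \<open>g'\<close> along with \<open>a'\<close>, and e contributes a single arrow. Exactness can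
  therefore be checked one \<open>b\<close> at a time.\<close>

lemma guitart_exact_local_descent:
  assumes D: "is_square D"
    and slices: "\<And>b. b \<in> Obj (BL D) \<Longrightarrow> guitart_exact (h_comp D (slice_square (TL D) (BL D) (left_fctr D) b))"
  shows "guitart_exact D"
proof (rule guitart_exactI[OF D])
  note s = square_simps[OF D] cat_simps
  fix a b g
  assume a: "a \<in> Obj (TR D)" and b: "b \<in> Obj (BL D)" and g: "g \<in> Arr (BR D)"
    "Dom (BR D) g = ob (right_fctr D) a" "Cod (BR D) g = ob (bottom_fctr D) b"
  let ?E = "h_comp D (slice_square (TL D) (BL D) (left_fctr D) b)"
  let ?G = "guitart_cat ?E a undefined g" and ?H = "guitart_cat D a b g"
  have G: "zero_connected ?G"
    using a b g by (intro guitart_exactD[OF slices[OF b]]) auto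
  have Obj: "(pair_code (a', g'), f, undefined) \<in> Obj ?G \<longleftrightarrow> (a', f, g') \<in> Obj ?H" for a' f g'
  \<comment> \<open>Reassociating the defining equation requires composable arrows; in the other
    case both memberships fail.\<close>
  proof (cases "a' \<in> Obj (TL D) \<and> f \<in> Arr (TR D) \<and> Cod (TR D) f = ob (top_fctr D) a' \<and>
      g' \<in> Arr (BL D) \<and> Dom (BL D) g' = ob (left_fctr D) a' \<and> Cod (BL D) g' = b")
    case True
    then show ?thesis
      using b by (auto simp: guitart_Obj inj_image_mem_iff[OF inj_pair_code] slice_Obj s cat_assoc)
  next
    case False
    then show ?thesis
      by (auto simp: guitart_Obj inj_image_mem_iff[OF inj_pair_code] slice_Obj)
  qed
  let ?\<phi> = "\<lambda>(p, f, c :: 'a). (fst (inv pair_code p), f, snd (inv pair_code p))"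
  have \<phi>: "?\<phi> (pair_code (a', g'), f, c) = (a', f, g')" for a' g' f c
    by (simp add: inv_f_f inj_pair_code)
  have form: "\<exists>a' g' f. x = (pair_code (a', g'), f, undefined)" if "x \<in> Obj ?G" for x
    using that by (cases x) (auto simp: guitart_Obj)
  show "zero_connected ?H"
  proof (rule zero_connected_image[OF G guitart_bounds, where \<phi> = ?\<phi>])
    fix x assume "x \<in> Obj ?G"
    then show "?\<phi> x \<in> Obj ?H" using form[of x] Obj by (auto simp: inv_f_f inj_pair_code)
  next
    fix k assume k: "k \<in> Arr ?G"
    obtain x m y where k': "k = (x, m, y)" by (metis prod.exhaust)
    have xy: "x \<in> Obj ?G" "y \<in> Obj ?G" using k by (simp_all add: k' guitart_Arr)
    obtain a1 g1 f1 where x: "x = (pair_code (a1, g1), f1, undefined)" using form xy by blast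
    obtain a2 g2 f2 where y: "y = (pair_code (a2, g2), f2, undefined)" using form xy by blast
    obtain h where h: "h \<in> Arr (TL D)" "Dom (TL D) h = a1" "Cod (TL D) h = a2"
      "Comp (BL D) g2 (ar (left_fctr D) h) = g1" "Comp (TR D) (ar (top_fctr D) h) f1 = f2"
      using k by (auto simp: k' x y guitart_Arr inj_eq[OF inj_pair_code] slice_Arr)
    have "((a1, f1, g1), (a2, f2, g2)) \<in> zigzag ?H"
      by (rule guitart_zigzagI[where f' = h]) (use xy h Obj x y in auto)
    then show "(?\<phi> (Dom ?G k), ?\<phi> (Cod ?G k)) \<in> zigzag ?H"
      unfolding k' guitart_Dom guitart_Cod x y \<phi> .
  next
    fix y assume y: "y \<in> Obj ?H"
    obtain a' f g' where y': "y = (a', f, g')" by (metis prod.exhaust)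
    show "\<exists>x\<in>Obj ?G. y = ?\<phi> x"
      using y Obj unfolding y'
      by (intro bexI[of _ "(pair_code (a', g'), f, undefined)"]) (auto simp: inv_f_f inj_pair_code)
  qed
qed

section \<open>Squares with terminal corners\<close>

lemma terminal_fctr:
  assumes "is_functor A terminal_cat F"
  shows "x \<in> Obj A \<Longrightarrow> ob F x = undefined" "f \<in> Arr A \<Longrightarrow> ar F f = undefined"
  using assms by (auto simp: is_functor_def)

text \<open>Over three copies of e there is a single triple (a, b', g), and its Guitart category is
  A' with two trivial components added.\<close>

lemma guitart_exact_terminal_iff:
  assumes D: "is_square D" and e: "TR D = terminal_cat" "BL D = terminal_cat" "BR D = terminal_cat"
  shows "guitart_exact D \<longleftrightarrow> zero_connected (TL D)"
proof -
  let ?G = "guitart_cat D undefined undefined undefined"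
  note F = squareD(5,7)[OF D, unfolded e]
  note cat = squareD(1)[OF D]
  have Obj: "(a', f, g') \<in> Obj ?G \<longleftrightarrow> a' \<in> Obj (TL D) \<and> f = undefined \<and> g' = undefined" for a' f g'
    by (auto simp: guitart_Obj e terminal_fctr[OF F(1)] terminal_fctr[OF F(2)])
  have "guitart_exact D \<longleftrightarrow> zero_connected ?G"
    using D terminal_fctr(1)[OF squareD(8)[OF D, unfolded e]] terminal_fctr(1)[OF squareD(6)[OF D, unfolded e]]
    by (simp add: guitart_exact_def e)
  also have "\<dots> \<longleftrightarrow> zero_connected (TL D)"
  proof
    assume G: "zero_connected ?G"
    show "zero_connected (TL D)"
    proof (rule zero_connected_image[OF G guitart_bounds, where \<phi> = fst])
      fix k assume "k \<in> Arr ?G"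
      then show "(fst (Dom ?G k), fst (Cod ?G k)) \<in> zigzag (TL D)"
        by (cases k) (auto simp: guitart_Arr intro: zigzag_arr)
    qed (use Obj in \<open>force+\<close>)
  next
    assume "zero_connected (TL D)"
    then show "zero_connected ?G"
    proof (rule zero_connected_image[where \<phi> = "\<lambda>x. (x, undefined, undefined)"])
      fix f assume "f \<in> Arr (TL D)"
      then show "((Dom (TL D) f, undefined, undefined), (Cod (TL D) f, undefined, undefined)) \<in> zigzag ?G"
        using cat by (intro guitart_zigzagI[where f' = f]) (simp_all add: Obj e cat_simps)
    qed (use Obj cat in \<open>auto simp: cat_simps\<close>)
  qed
  finally show ?thesis .
qed

text \<open>All arrows of e coincide, so the commutativity asked of the generating squares over e is
  automatic.\<close>

lemma commutative_square_terminal: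
  assumes D: "is_square D" and e: "BR D = terminal_cat"
  shows "commutative_square D"
proof -
  note s = square_simps[OF D, unfolded e]
  show ?thesis
    unfolding commutative_square_def eq_fctr_def
    using D s terminal_fctr[OF squareD(6)[OF D, unfolded e]] terminal_fctr[OF squareD(8)[OF D, unfolded e]]
    by (auto simp: e)
qed

section \<open>The exact squares have all the closure properties\<close>

lemma guitart_class_guitart_exact: "guitart_class {D :: ('u::infinite) square. guitart_exact D}"
  unfolding guitart_class_def
proof (intro conjI)
  show "local_descent {D :: 'u square. guitart_exact D}"
    unfolding local_descent_def using guitart_exact_local_descent by blast
  show "contains_connected_squares {D :: 'u square. guitart_exact D}"
    unfolding contains_connected_squares_def
    using guitart_exact_terminal_iff by (auto simp: commutative_square_def)
qed (auto simp: iso_closed_def opp_stable_def h_comp_stable_def contains_comma_squares_def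
    intro: guitart_exact_square guitart_exact_iso guitart_exact_opp guitart_exact_h_comp guitart_exact_comma)

section \<open>Minimality\<close>

text \<open>Descent in the form used for the reductions: the composites with slices may be assumed
  exact, because exactness passes to them.\<close>

lemma guitart_class_descent:
  assumes Q: "guitart_class Q" and D: "guitart_exact D"
    and slices: "\<And>b. b \<in> Obj (BL D) \<Longrightarrow> guitart_exact (h_comp D (slice_square (TL D) (BL D) (left_fctr D) b)) \<Longrightarrow>
      h_comp D (slice_square (TL D) (BL D) (left_fctr D) b) \<in> Q"
  shows "D \<in> Q"
  using Q slices guitart_exact_square[OF D] guitart_exact_h_comp_slice[OF D]
  unfolding guitart_class_def local_descent_def by blast

lemma guitart_class_opp_iff:
  assumes "guitart_class Q"
  shows "opp_square D \<in> Q \<longleftrightarrow> D \<in> Q"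
  using assms opp_square_opp unfolding guitart_class_def opp_stable_def by metis

text \<open>In the opposite square A becomes the bottom left corner, so the composites with slices
  over its objects have e at every corner but the top left. In the application A is discrete and
  these slices are the fibres of v, up to opposites.\<close>

lemma guitart_class_terminal_base:
  assumes Q: "guitart_class Q" and D: "guitart_exact D" and e: "BL D = terminal_cat" "BR D = terminal_cat"
  shows "D \<in> Q"
proof -
  have "opp_square D \<in> Q"
  proof (rule guitart_class_descent[OF Q guitart_exact_opp[OF D]])
    fix b
    let ?R = "h_comp (opp_square D)
      (slice_square (TL (opp_square D)) (BL (opp_square D)) (left_fctr (opp_square D)) b)"
    assume R: "guitart_exact ?R"
    have c: "TR ?R = terminal_cat" "BL ?R = terminal_cat" "BR ?R = terminal_cat"
      by (simp_all add: opp_square_def e)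
    have sq: "is_square ?R" using R by (rule guitart_exact_square)
    have "zero_connected (TL ?R)"
      using guitart_exact_terminal_iff[OF sq c] R by blast
    then show "?R \<in> Q"
      using Q commutative_square_terminal[OF sq c(3)] c
      unfolding guitart_class_def contains_connected_squares_def by blast
  qed
  then show ?thesis by (simp add: guitart_class_opp_iff[OF Q])
qed

text \<open>Each element is its own identity arrow, so a set of arrows of B becomes a small category
  without coding. Composable arrows are equal, whence the projection as composition.\<close>

definition discrete_cat :: "'u set \<Rightarrow> 'u small_cat" where
  "discrete_cat H = \<lparr>Obj = H, Arr = H, Dom = (\<lambda>x. x), Cod = (\<lambda>x. x), Ide = (\<lambda>x. x), Comp = (\<lambda>g f. f)\<rparr>"

lemma discrete_simps [simp]:
  "Obj (discrete_cat H) = H" "Arr (discrete_cat H) = H" "Dom (discrete_cat H) x = x"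
  "Cod (discrete_cat H) x = x" "Ide (discrete_cat H) x = x" "Comp (discrete_cat H) g f = f"
  by (simp_all add: discrete_cat_def)

lemma category_discrete: "category (discrete_cat H)"
  by (simp add: category_def)

text \<open>The comma square of two objects x, y of B, given as functors from e. Its top left corner
  is presented on the arrows x -> y themselves instead of on coded triples.\<close>

definition hom_square :: "'u small_cat \<Rightarrow> 'u small_fctr \<Rightarrow> 'u small_fctr \<Rightarrow> 'u square" where
  "hom_square B u w =
     \<lparr>TL = discrete_cat {g \<in> Arr B. Dom B g = ob u undefined \<and> Cod B g = ob w undefined},
      TR = terminal_cat, BL = terminal_cat, BR = B,
      top_fctr = const_fctr terminal_cat undefined, bottom_fctr = w,
      left_fctr = const_fctr terminal_cat undefined, right_fctr = u, two_cell = (\<lambda>g. g)\<rparr>"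

text \<open>An arrow of the comma category from \<open>g1\<close> to \<open>g2\<close> has
  identities as components, so its condition reads \<open>g2 = g1\<close>: the comma category is
  discrete.\<close>

lemma comma_square_hom:
  assumes B: "category B" and u: "is_functor terminal_cat B u" and w: "is_functor terminal_cat B w"
  shows "comma_square (hom_square B u w)"
proof -
  let ?H = "{g \<in> Arr B. Dom B g = ob u undefined \<and> Cod B g = ob w undefined}"
  let ?C = "comma_cat terminal_cat terminal_cat B u w"
  have ide: "ar u undefined = Ide B (ob u undefined)" "ar w undefined = Ide B (ob w undefined)"
    using fctr_Ide[OF u, of undefined] fctr_Ide[OF w, of undefined] by simp_all
  have const: "is_functor (discrete_cat ?H) terminal_cat (const_fctr terminal_cat undefined)"
    by (intro is_functor_const category_discrete category_terminal) simp
  have "is_square (hom_square B u w)"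
    using assms const by (auto simp: is_square_def hom_square_def category_discrete category_terminal
        is_nat_trans_def ide cat_simps)
  moreover have "is_iso_fctr (discrete_cat ?H) ?C (comma_comparison (hom_square B u w))"
    unfolding is_iso_fctr_def
  proof (intro conjI exI)
    \<comment> \<open>The inverse keeps only the arrow of B; for an arrow of the comma category it
      is read off the source, where it is the same as at the target.\<close>
    let ?G = "\<lparr>ob = (\<lambda>(_, _, g). g), ar = (\<lambda>((_, _, g), _, _). g)\<rparr>"
    show "is_functor (discrete_cat ?H) ?C (comma_comparison (hom_square B u w))"
      using B by (auto simp: is_functor_def comma_comparison_def hom_square_def comma_cat_def ide cat_simps)
    show "is_functor ?C (discrete_cat ?H) ?G"
      using B by (auto simp: is_functor_def comma_cat_def ide cat_simps)
    show "eq_fctr (discrete_cat ?H) (comp_fctr ?G (comma_comparison (hom_square B u w))) id_fctr"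
      by (auto simp: eq_fctr_def comma_comparison_def hom_square_def)
    show "eq_fctr ?C (comp_fctr (comma_comparison (hom_square B u w)) ?G) id_fctr"
      using B by (auto simp: eq_fctr_def comma_comparison_def hom_square_def comma_cat_def ide cat_simps)
  qed
  ultimately show ?thesis
    by (simp add: comma_square_def) (simp add: hom_square_def)
qed

lemma guitart_class_terminal_sides:
  assumes Q: "guitart_class Q" and D: "guitart_exact D" and e: "TR D = terminal_cat" "BL D = terminal_cat"
  shows "D \<in> Q"
proof -
  have sq: "is_square D" using D by (rule guitart_exact_square)
  note F = squareD[OF sq, unfolded e]
  note cell = square_cell[OF sq]
  note tv = terminal_fctr[OF F(5)] terminal_fctr[OF F(7)]
  have ide: "ar (right_fctr D) undefined = Ide (BR D) (ob (right_fctr D) undefined)"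
    "ar (bottom_fctr D) undefined = Ide (BR D) (ob (bottom_fctr D) undefined)"
    using fctr_Ide[OF F(6), of undefined] fctr_Ide[OF F(8), of undefined] by simp_all
  \<comment> \<open>Both functors to e followed by u or w send \<open>f\<close> to an identity, so
    the outer factors of the naturality equation disappear.\<close>
  have natural: "two_cell D (Cod (TL D) f) = two_cell D (Dom (TL D) f)" if "f \<in> Arr (TL D)" for f
    using that cell(4)[of f] cell(1-3) F(1,4) by (simp add: tv ide cat_simps)
  let ?C = "hom_square (BR D) (right_fctr D) (bottom_fctr D)"
  \<comment> \<open>The factor over e -> e: its top functor is the 2-cell of \<open>D\<close>, which
    by \<open>natural\<close> can send an arrow to the identity of the common value at its
    ends.\<close>
  define S where "S = \<lparr>TL = TL D, TR = TL ?C, BL = terminal_cat, BR = terminal_cat,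
    top_fctr = \<lparr>ob = two_cell D, ar = \<lambda>f. two_cell D (Dom (TL D) f)\<rparr>,
    bottom_fctr = const_fctr terminal_cat undefined, left_fctr = left_fctr D,
    right_fctr = const_fctr terminal_cat undefined, two_cell = (\<lambda>_. undefined)\<rparr>"
  have S [simp]: "TL S = TL D" "BL S = terminal_cat" "BR S = terminal_cat" "left_fctr S = left_fctr D"
    "ob (top_fctr S) x = two_cell D x" "ar (top_fctr S) f = two_cell D (Dom (TL D) f)"
    "bottom_fctr S = const_fctr terminal_cat undefined" "right_fctr S = const_fctr terminal_cat undefined"
    "two_cell S x = undefined"
    "TR S = discrete_cat {g \<in> Arr (BR D). Dom (BR D) g = ob (right_fctr D) undefined \<and>
       Cod (BR D) g = ob (bottom_fctr D) undefined}" for x f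
    by (simp_all add: S_def hom_square_def)
  have "is_functor (TL D) (TR S) (top_fctr S)"
    using F(1) cell(1-3) by (auto simp: is_functor_def natural tv cat_simps)
  then have sqS: "is_square S"
    using F by (auto simp: is_square_def category_discrete category_terminal is_functor_const is_nat_trans_def)
  have "guitart_exact S"
  proof (rule guitart_exactI[OF sqS])
    fix a b g
    assume "a \<in> Obj (TR S)" "b \<in> Obj (BL S)" "g \<in> Arr (BR S)"
    then have bg: "b = undefined" "g = undefined"
      and a: "a \<in> Arr (BR D)" "Dom (BR D) a = ob (right_fctr D) undefined"
        "Cod (BR D) a = ob (bottom_fctr D) undefined" by simp_all
    \<comment> \<open>Both categories are the fibre of the 2-cell over \<open>a\<close>. For
      \<open>D\<close> the condition comes from the equation in B, for \<open>S\<close> from the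
      existence of an arrow out of \<open>a\<close> in a discrete category.\<close>
    let ?G = "guitart_cat D undefined undefined a" and ?H = "guitart_cat S a undefined undefined"
    have G: "zero_connected ?G"
      using a by (intro guitart_exactD[OF D]) (simp_all add: e)
    have Obj: "(a', f, g') \<in> Obj ?G \<longleftrightarrow>
        a' \<in> Obj (TL D) \<and> f = undefined \<and> g' = undefined \<and> two_cell D a' = a" for a' f g'
      using F(4) cell(1-3) by (auto simp: guitart_Obj e tv ide cat_simps)
    have ObjS: "(a', f, g') \<in> Obj ?H \<longleftrightarrow>
        a' \<in> Obj (TL D) \<and> f = a \<and> g' = undefined \<and> two_cell D a' = a" for a' f g'
      using a by (auto simp: guitart_Obj tv)
    have "zero_connected ?H"
    proof (rule zero_connected_image[OF G guitart_bounds, where \<phi> = "\<lambda>(a', _, _). (a', a, undefined)"])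
      fix k assume k: "k \<in> Arr ?G"
      obtain a1 f1 g1 h a2 f2 g2 where [simp]: "k = ((a1, f1, g1), h, (a2, f2, g2))" by (metis prod.exhaust)
      have "((a1, a, undefined), (a2, a, undefined)) \<in> zigzag ?H"
      proof (rule guitart_zigzagI[where f' = h])
        show "(a1, a, undefined) \<in> Obj ?H" "(a2, a, undefined) \<in> Obj ?H"
          using k unfolding ObjS by (simp_all add: guitart_Arr Obj)
        then show "Comp (TR S) (ar (top_fctr S) h) a = a"
          using k by (simp add: guitart_Arr ObjS)
      qed (use k in \<open>simp_all add: guitart_Arr Obj\<close>)
      then show "((\<lambda>(a', _, _). (a', a, undefined)) (Dom ?G k), (\<lambda>(a', _, _). (a', a, undefined)) (Cod ?G k))
          \<in> zigzag ?H" by simp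
    next
      fix y assume y: "y \<in> Obj ?H"
      have "y = (fst y, a, undefined)" "(fst y, undefined, undefined) \<in> Obj ?G"
        using y unfolding Obj by (cases y, simp add: ObjS)+
      then show "\<exists>x\<in>Obj ?G. y = (case x of (a', _, _) \<Rightarrow> (a', a, undefined))"
        by (intro bexI[of _ "(fst y, undefined, undefined)"]) auto
    qed (auto simp: Obj ObjS)
    then show "zero_connected (guitart_cat S a b g)" unfolding bg .
  qed
  then have "S \<in> Q" using guitart_class_terminal_base[OF Q] by simp
  moreover have C: "comma_square ?C" using F by (intro comma_square_hom)
  then have "?C \<in> Q" using Q by (auto simp: guitart_class_def contains_comma_squares_def)
  moreover have hc: "h_composable ?C S"
    by (simp add: h_composable_def) (simp add: hom_square_def)
  ultimately have mem: "h_comp ?C S \<in> Q"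
    using Q by (auto simp: guitart_class_def h_comp_stable_def)
  have "is_square (h_comp ?C S)"
    using C sqS hc by (intro is_square_h_comp) (simp_all add: comma_square_def)
  \<comment> \<open>Agreement with \<open>D\<close> is only on carriers: constant functors stand in
    for those to e, and the 2-cell is that of \<open>D\<close> followed by w of an identity.
    Identity functors therefore give an isomorphism of squares where an equality may fail.\<close>
  then have "iso_square (h_comp ?C S) D"
    unfolding iso_square_def using sq F(1,4,6,8) cell(1-3) is_iso_fctr_id
    by (intro conjI exI[of _ id_fctr])
      (auto simp: hom_square_def e eq_fctr_def tv ide cat_simps fctr_simps)
  then show ?thesis using Q mem unfolding guitart_class_def iso_closed_def by blast
qed

text \<open>The opposite moves e from \<open>BL\<close> to \<open>TR\<close>, where slicing leaves
  it, while slicing puts e at \<open>BL\<close> again.\<close>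

lemma guitart_class_terminal_left:
  assumes Q: "guitart_class Q" and D: "guitart_exact D" and e: "BL D = terminal_cat"
  shows "D \<in> Q"
proof -
  have "opp_square D \<in> Q"
    by (rule guitart_class_descent[OF Q guitart_exact_opp[OF D]], rule guitart_class_terminal_sides[OF Q])
      (auto simp: opp_square_def e)
  then show ?thesis by (simp add: guitart_class_opp_iff[OF Q])
qed

lemma guitart_exact_mem_guitart_class:
  assumes Q: "guitart_class Q" and D: "guitart_exact D"
  shows "D \<in> Q"
  by (rule guitart_class_descent[OF Q D], rule guitart_class_terminal_left[OF Q]) auto

theorem mainTheorem3:
  shows "guitart_class {D :: ('u::infinite) square. guitart_exact D} \<and>
         (\<forall>Q :: 'u square set. guitart_class Q \<longrightarrow> {D. guitart_exact D} \<subseteq> Q)"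
  using guitart_class_guitart_exact guitart_exact_mem_guitart_class by blast

end
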